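(* Let $f:\mathbb{R}\to\mathbb{R}$ be locally Lipschitz continuous, increasing and odd, with $f(0)=0$ and $xf(x)>0$ for all $x\neq 0$. Suppose that there exists $\epsilon_0\in(0,1)$ such that for every $\epsilon\in(0,\epsilon_0)$ $$\underline{\Phi}_f(\epsilon):=\liminf_{x\to 0^+}\frac{f((1-\epsilon)x)}{f(x)}>0,\qquad\text{and}\quad \underline{\Phi}_f(\epsilon)\to 1\ \text{ as } \epsilon\to 0^+,$$ and that $$\limsup_{x\to 0^+}\frac{f(\mu x)}{f(x)}<\mu\quad\text{for all }\mu\in(0,1).$$ Let $\sigma:[0,\infty)\to\mathbb{R}$ be continuous, let $B$ be a one-dimensional standard Brownian motion, let $\xi\in\mathbb{R}$ be deterministic, and let $X$ be the unique continuous adapted process satisfying $$dX(t)=-f(X(t))\,dt+\sigma(t)\,dB(t),\quad t\ge 0,\qquad X(0)=\xi.$$ Then the following are equivalent: (A) $\sigma\in L^2(0,\infty)$ and $$\lim_{t\to\infty}\frac{\int_t^\infty\sigma(s)\,dB(s)}{F^{-1}(t)}=0\quad\text{almost surely};$$ (B) there is a random variable $\Lambda$, which takes only the values $1,0,-1$, such that $$\lim_{t\to\infty}\frac{X(t)}{F^{-1}(t)}=\Lambda\quad\text{almost surely}.$$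
   Context: $F:(0,\infty)\to\mathbb{R}$ is defined by $F(x)=\int_x^1 \frac{1}{f(u)}\,du$. It is strictly decreasing, and $F^{-1}$ denotes its inverse function. Under the stated hypotheses $F(x)\to+\infty$ as $x\to0^+$, so $F^{-1}(t)$ is defined for all $t\ge 0$. "Adapted" refers to the natural filtration generated by $B$. When $\sigma\in L^2(0,\infty)$, $\int_t^\infty\sigma(s)\,dB(s)$ denotes the almost surely existing limit $\lim_{T\to\infty}\int_0^T\sigma(s)\,dB(s)-\int_0^t\sigma(s)\,dB(s)$, taken pathwise on an almost sure event. *)

theory Defs
  imports "HOL-Probability.Probability"
begin

text \<open>Processes are indexed by real times, and only the values at times \<open>t \<ge> 0\<close> matter.\<close>

definition brownian_motion :: "'a measure \<Rightarrow> (real \<Rightarrow> 'a \<Rightarrow> real) \<Rightarrow> bool" where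
  "brownian_motion M B \<longleftrightarrow>
     prob_space M \<and>
     (\<forall>t\<ge>0. B t \<in> borel_measurable M) \<and>
     (AE \<omega> in M. B 0 \<omega> = 0) \<and>
     (\<forall>s t. 0 \<le> s \<longrightarrow> s < t \<longrightarrow>
        distributed M lborel (\<lambda>\<omega>. B t \<omega> - B s \<omega>) (normal_density 0 (sqrt (t - s)))) \<and>
     (\<forall>(n::nat) p. 0 \<le> p 0 \<longrightarrow> (\<forall>i<n. p i \<le> p (Suc i)) \<longrightarrow>
        prob_space.indep_vars M (\<lambda>_. borel) (\<lambda>i \<omega>. B (p (Suc i)) \<omega> - B (p i) \<omega>) {..<n}) \<and>
     (AE \<omega> in M. continuous_on {0..} (\<lambda>t. B t \<omega>))"

text \<open>The natural filtration of \<open>B\<close>, augmented as usual by the null sets, so that a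
  continuous version of an adapted process stays adapted.\<close>

definition natural_filtration ::
  "'a measure \<Rightarrow> (real \<Rightarrow> 'a \<Rightarrow> real) \<Rightarrow> real \<Rightarrow> 'a measure" where
  "natural_filtration M B t =
     sigma (space M)
       ({B s -` A \<inter> space M |s A. s \<in> {0..t} \<and> A \<in> sets borel} \<union> null_sets M)"

definition adapted_process ::
  "'a measure \<Rightarrow> (real \<Rightarrow> 'a \<Rightarrow> real) \<Rightarrow> (real \<Rightarrow> 'a \<Rightarrow> real) \<Rightarrow> bool" where
  "adapted_process M B X \<longleftrightarrow> (\<forall>t\<ge>0. X t \<in> borel_measurable (natural_filtration M B t))"

definition step_fun :: "nat \<Rightarrow> (nat \<Rightarrow> real) \<Rightarrow> (nat \<Rightarrow> real) \<Rightarrow> real \<Rightarrow> real" where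
  "step_fun n p c s = (\<Sum>i<n. c i * indicator {p i<..p (Suc i)} s)"

definition step_integral ::
  "(real \<Rightarrow> 'a \<Rightarrow> real) \<Rightarrow> nat \<Rightarrow> (nat \<Rightarrow> real) \<Rightarrow> (nat \<Rightarrow> real) \<Rightarrow> 'a \<Rightarrow> real" where
  "step_integral B n p c \<omega> = (\<Sum>i<n. c i * (B (p (Suc i)) \<omega> - B (p i) \<omega>))"

text \<open>\<open>Y\<close> is (a version of) the Ito integral of the deterministic function \<open>\<sigma>\<close> over
  \<open>[0,t]\<close>: the limit in \<open>L\<^sup>2(M)\<close> of the integrals of step functions that
  converge to \<open>\<sigma>\<close> in \<open>L\<^sup>2(0,t)\<close>. The nonnegative integral is used because the
  Bochner integral of a non-integrable function is 0.\<close>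

definition has_ito_integral ::
  "'a measure \<Rightarrow> (real \<Rightarrow> 'a \<Rightarrow> real) \<Rightarrow> (real \<Rightarrow> real) \<Rightarrow> real \<Rightarrow> ('a \<Rightarrow> real) \<Rightarrow> bool" where
  "has_ito_integral M B \<sigma> t Y \<longleftrightarrow>
     Y \<in> borel_measurable M \<and>
     (\<exists>(n :: nat \<Rightarrow> nat) p c.
        (\<forall>k. p k 0 = 0 \<and> p k (n k) = t \<and> (\<forall>i<n k. p k i \<le> p k (Suc i))) \<and>
        (\<lambda>k. \<integral>\<^sup>+ s\<in>{0..t}. ennreal ((\<sigma> s - step_fun (n k) (p k) (c k) s)\<^sup>2) \<partial>lborel)
          \<longlonglongrightarrow> 0 \<and>
        (\<lambda>k. \<integral>\<^sup>+ \<omega>. ennreal ((Y \<omega> - step_integral B (n k) (p k) (c k) \<omega>)\<^sup>2) \<partial>M)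
          \<longlonglongrightarrow> 0)"

text \<open>\<open>I\<close> is the (up to indistinguishability unique) continuous process
  \<open>t \<mapsto> \<integral>\<^sub>0\<^sup>t \<sigma>(s) dB(s)\<close>.\<close>

definition ito_integral_process ::
  "'a measure \<Rightarrow> (real \<Rightarrow> 'a \<Rightarrow> real) \<Rightarrow> (real \<Rightarrow> real) \<Rightarrow> (real \<Rightarrow> 'a \<Rightarrow> real) \<Rightarrow> bool" where
  "ito_integral_process M B \<sigma> I \<longleftrightarrow>
     (\<forall>t\<ge>0. has_ito_integral M B \<sigma> t (I t)) \<and>
     (AE \<omega> in M. continuous_on {0..} (\<lambda>t. I t \<omega>))"

text \<open>The pathwise tail \<open>\<integral>\<^sub>t\<^sup>\<infinity> \<sigma>(s) dB(s)\<close>, for \<open>I\<close> as above; for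
  \<open>\<sigma>\<close> in \<open>L\<^sup>2(0,\<infinity>)\<close> the limit exists almost surely.\<close>

definition tail_integral :: "(real \<Rightarrow> 'a \<Rightarrow> real) \<Rightarrow> real \<Rightarrow> 'a \<Rightarrow> real" where
  "tail_integral I t \<omega> = Lim at_top (\<lambda>T. I T \<omega>) - I t \<omega>"

text \<open>\<open>X\<close> is a continuous adapted solution of \<open>dX = -f(X) dt + \<sigma> dB\<close>,
  \<open>X(0) = \<xi>\<close>, where \<open>I\<close> is the process \<open>\<integral>\<^sub>0\<^sup>t \<sigma>(s) dB(s)\<close>.\<close>

definition sde_solution ::
  "'a measure \<Rightarrow> (real \<Rightarrow> 'a \<Rightarrow> real) \<Rightarrow> (real \<Rightarrow> real) \<Rightarrow> (real \<Rightarrow> 'a \<Rightarrow> real) \<Rightarrow> real \<Rightarrow>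
    (real \<Rightarrow> 'a \<Rightarrow> real) \<Rightarrow> bool" where
  "sde_solution M B f I \<xi> X \<longleftrightarrow>
     adapted_process M B X \<and>
     (AE \<omega> in M. continuous_on {0..} (\<lambda>t. X t \<omega>)) \<and>
     (AE \<omega> in M. \<forall>t\<ge>0. X t \<omega> = \<xi> - (LBINT s:{0..t}. f (X s \<omega>)) + I t \<omega>)"

text \<open>The interval integral is oriented, so \<open>F f x < 0\<close> for \<open>x > 1\<close>.\<close>

definition F :: "(real \<Rightarrow> real) \<Rightarrow> real \<Rightarrow> real" where
  "F f x = (LBINT u=ereal x..ereal 1. 1 / f u)"

definition F_inv :: "(real \<Rightarrow> real) \<Rightarrow> real \<Rightarrow> real" where
  "F_inv f = inv_into {0<..} (F f)"

definition Phi_low :: "(real \<Rightarrow> real) \<Rightarrow> real \<Rightarrow> ereal" where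
  "Phi_low f \<epsilon> = Liminf (at_right 0) (\<lambda>x. ereal (f ((1 - \<epsilon>) * x) / f x))"

end

theory Submission
  imports Defs
begin

text \<open>
  The theorem is proved path by path. Let \<open>y = F\<inverse>\<close>, so that \<open>y' = - f y\<close> and \<open>y \<longrightarrow> 0\<close>, and let
  \<open>T\<close> be the tail of the stochastic integral.

  If \<open>T = o(y)\<close>, then \<open>Z = X + T\<close> is differentiable with \<open>Z' = - f (Z - T)\<close>, and \<open>w = Z / y\<close> satisfies
  \<open>w' = (f y / y) (w - f (w y - T) / f y)\<close>. By the hypotheses on \<open>f\<close> the sign of \<open>w'\<close> is eventually
  constant near any level other than \<open>0, 1, -1\<close>. So \<open>w\<close> crosses such a level at most once
  at large times and therefore converges in the extended reals. Another finite limit is excluded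
  because \<open>f y / y = - (ln y)'\<close> is not integrable at infinity, and an infinite one because \<open>w\<close>
  eventually decreases wherever it is large.

  Conversely, if \<open>X / y \<longrightarrow> \<Lambda>\<close>, then \<open>f X / f y \<longrightarrow> \<Lambda>\<close>, so the drift accumulated after time \<open>t\<close> is
  \<open>\<Lambda> y + o(y)\<close> and \<open>T = o(y)\<close>. The stochastic integral is then almost surely bounded; as it is
  an \<open>L\<^sup>2\<close> limit of Gaussian variables, its variance must stay bounded.
\<close>

section \<open>Scalar comparison principles\<close>

text \<open>At a first return to \<open>a\<close> the derivative would be negative, so
  \<open>w\<close> would exceed \<open>a\<close> just before and, by continuity, would have met
  \<open>a\<close> even earlier.\<close>

lemma barrier_no_return:
  fixes w D :: "real \<Rightarrow> real"
  assumes deriv: "\<And>t. t \<ge> t1 \<Longrightarrow> (w has_real_derivative D t) (at t)"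
    and neg: "\<And>t. t \<ge> t1 \<Longrightarrow> w t = a \<Longrightarrow> D t < 0"
    and start: "w t1 \<le> a" and "t > t1"
  shows "w t < a"
proof (rule ccontr)
  assume "\<not> w t < a"
  then have wt: "w t \<ge> a" by simp
  have cont: "continuous_on {u..v} w" if "t1 \<le> u" for u v
    by (intro continuous_at_imp_continuous_on ballI DERIV_isCont[OF deriv]) (use that in auto)
  \<comment> \<open>A start exactly on the level is allowed: the negative derivative at
    \<open>t1\<close> then moves \<open>w\<close> strictly below it.\<close>
  obtain u where u: "t1 \<le> u" "u < t" "w u < a"
  proof (cases "w t1 = a")
    case True
    then have "D t1 < 0" using neg by auto
    from DERIV_neg_dec_right[OF deriv this] obtain d
      where d: "d > 0" "\<And>h. h > 0 \<Longrightarrow> h < d \<Longrightarrow> w (t1 + h) < w t1" by auto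
    let ?h = "min (d/2) ((t - t1)/2)"
    have "w (t1 + ?h) < w t1" using d \<open>t > t1\<close> by (intro d(2)) auto
    then show thesis
      using d \<open>t > t1\<close> True by (intro that[of "t1 + ?h"]) (auto simp: min_def field_simps)
  next
    case False
    then show thesis using start \<open>t > t1\<close> by (intro that[of t1]) auto
  qed
  define S where "S = {s \<in> {u..t}. w s = a}"
  have Seq: "S = {u..t} \<inter> w -` {a}" by (auto simp: S_def)
  have "closed S" unfolding Seq
    by (rule continuous_closed_preimage[OF cont]) (use u in auto)
  then have "compact S"
    unfolding compact_eq_bounded_closed Seq
    by (auto intro: bounded_subset[OF bounded_closed_interval])
  moreover have "\<exists>s\<ge>u. s \<le> t \<and> w s = a"
    by (rule IVT'[where f = w]) (use u wt cont in auto)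
  then have "S \<noteq> {}" by (auto simp: S_def)
  ultimately obtain s where s: "s \<in> S" "\<And>r. r \<in> S \<Longrightarrow> s \<le> r"
    using compact_attains_inf by metis
  have su: "u < s" "s \<le> t" "w s = a" using s(1) u by (auto simp: S_def less_le)
  have "D s < 0" using neg su u by auto
  from DERIV_neg_dec_left[OF deriv this] su u obtain d
    where d: "d > 0" "\<And>h. h > 0 \<Longrightarrow> h < d \<Longrightarrow> w s < w (s - h)" by auto
  let ?h = "min (d/2) ((s - u)/2)"
  have "a < w (s - ?h)" using d su by auto
  moreover have h: "u \<le> s - ?h" "s - ?h < s" using d su by (auto simp: min_def field_simps)
  ultimately have "\<exists>r\<ge>u. r \<le> s - ?h \<and> w r = a"
    by (intro IVT'[where f = w]) (use u cont in auto)
  then obtain r where "r \<ge> u" "r \<le> s - ?h" "w r = a" by blast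
  then show False using s(2)[of r] h su by (force simp: S_def)
qed

text \<open>Either \<open>w\<close> is at or below \<open>a\<close> at some late time and never
  returns, or it stays above from then on.\<close>

lemma barrier_dichotomy:
  fixes w D :: "real \<Rightarrow> real"
  assumes deriv: "\<And>t. t > 0 \<Longrightarrow> (w has_real_derivative D t) (at t)"
    and ev: "\<forall>\<^sub>F t in at_top. w t = a \<longrightarrow> D t < 0"
  shows "(\<forall>\<^sub>F t in at_top. w t < a) \<or> (\<forall>\<^sub>F t in at_top. w t > a)"
proof -
  from ev obtain t0 where t0: "\<And>t. t \<ge> t0 \<Longrightarrow> w t = a \<longrightarrow> D t < 0"
    by (auto simp: eventually_at_top_linorder)
  define t2 where "t2 = max t0 1"
  show ?thesis
  proof (cases "\<exists>t1\<ge>t2. w t1 \<le> a")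
    case True
    then obtain t1 where t1: "t1 \<ge> t2" "w t1 \<le> a" by blast
    have "w t < a" if "t > t1" for t
      by (rule barrier_no_return[of t1 w D a]) (use t1 t0 deriv that in \<open>auto simp: t2_def\<close>)
    then have "\<forall>\<^sub>F t in at_top. w t < a" by (rule eventually_at_top_dense[THEN iffD2, OF exI, OF allI, OF impI])
    then show ?thesis ..
  next
    case False
    then have "\<forall>\<^sub>F t in at_top. w t > a"
      by (intro eventually_at_top_linorderI[of t2]) force
    then show ?thesis ..
  qed
qed

text \<open>If the lower and upper limits differed, the gap between them would contain a level
  outside the finite set \<open>S\<close>, and \<open>w\<close> could settle on neither side of
  it.\<close>

lemma ereal_limit_of_dichotomy:
  fixes w :: "'b \<Rightarrow> real"
  assumes "finite S" "G \<noteq> bot"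
    and dich: "\<And>a. a \<notin> S \<Longrightarrow> (\<forall>\<^sub>F t in G. w t < a) \<or> (\<forall>\<^sub>F t in G. w t > a)"
  shows "\<exists>l::ereal. ((\<lambda>t. ereal (w t)) \<longlongrightarrow> l) G"
proof -
  let ?w = "\<lambda>t. ereal (w t)"
  have "Liminf G ?w = Limsup G ?w"
  proof (rule ccontr)
    assume "Liminf G ?w \<noteq> Limsup G ?w"
    with Liminf_le_Limsup[OF \<open>G \<noteq> bot\<close>, of ?w] have "Liminf G ?w < Limsup G ?w" by auto
    then obtain p where p: "Liminf G ?w < ereal p" "ereal p < Limsup G ?w" using ereal_dense2 by blast
    then obtain q where q: "ereal p < ereal q" "ereal q < Limsup G ?w" using ereal_dense2 by blast
    have "infinite {p<..<q}" using q by (auto simp: infinite_Ioo)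
    then obtain a where a: "a \<notin> S" "p < a" "a < q"
      using \<open>finite S\<close> by (meson finite_subset greaterThanLessThan_iff subsetI)
    from dich[OF a(1)] show False
    proof
      assume "\<forall>\<^sub>F t in G. w t < a"
      then have "Limsup G ?w \<le> ereal a"
        by (intro Limsup_bounded) (auto elim: eventually_mono)
      with q a show False by (meson ereal_less_eq(3) less_le_not_le order_trans)
    next
      assume "\<forall>\<^sub>F t in G. w t > a"
      then have "ereal a \<le> Liminf G ?w"
        by (intro Liminf_bounded) (auto elim: eventually_mono)
      with p a show False by (meson ereal_less_eq(3) less_le_not_le order_trans)
    qed
  qed
  then have "(?w \<longlongrightarrow> Limsup G ?w) G"
    using \<open>G \<noteq> bot\<close> by (intro Liminf_eq_Limsup) auto
  then show ?thesis by blast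
qed

lemma eventually_decreasing:
  fixes w D :: "real \<Rightarrow> real"
  assumes deriv: "\<And>t. t > 0 \<Longrightarrow> (w has_real_derivative D t) (at t)"
    and ev: "\<forall>\<^sub>F t in at_top. D t \<le> 0"
  shows "\<exists>t0>0. \<forall>s t. t0 \<le> s \<longrightarrow> s \<le> t \<longrightarrow> w t \<le> w s"
proof -
  from ev obtain t0 where t0: "\<And>t. t \<ge> t0 \<Longrightarrow> D t \<le> 0"
    by (auto simp: eventually_at_top_linorder)
  have "w t \<le> w s" if "max t0 1 \<le> s" "s \<le> t" for s t
  proof (rule DERIV_nonpos_imp_nonincreasing[OF \<open>s \<le> t\<close>])
    fix x assume "s \<le> x" "x \<le> t"
    then show "\<exists>y. (w has_real_derivative y) (at x) \<and> y \<le> 0"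
      using t0[of x] deriv[of x] that by (intro exI[of _ "D x"]) auto
  qed
  then show ?thesis by (intro exI[of _ "max t0 1"]) auto
qed

text \<open>Non-integrability of the drift at infinity is encoded by an antiderivative
  \<open>g\<close> that tends to infinity; \<open>w + g\<close> is eventually nonincreasing, hence
  bounded above.\<close>

lemma drift_to_bot:
  fixes w D g E :: "real \<Rightarrow> real"
  assumes w: "\<And>t. t > 0 \<Longrightarrow> (w has_real_derivative D t) (at t)"
    and g: "\<And>t. t > 0 \<Longrightarrow> (g has_real_derivative E t) (at t)"
    and ev: "\<forall>\<^sub>F t in at_top. D t \<le> - E t"
    and lim: "filterlim g at_top at_top"
  shows "filterlim w at_bot at_top"
proof -
  have "\<exists>t0>0. \<forall>s t. t0 \<le> s \<longrightarrow> s \<le> t \<longrightarrow> w t + g t \<le> w s + g s"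
    by (rule eventually_decreasing[where D = "\<lambda>t. D t + E t"])
      (use w g ev in \<open>auto intro!: DERIV_add elim: eventually_mono\<close>)
  then obtain t0 where t0: "\<And>t. t \<ge> t0 \<Longrightarrow> w t \<le> w t0 + g t0 - g t" by force
  have "filterlim (\<lambda>t. - (w t0 + g t0) + g t) at_top at_top"
    by (rule filterlim_tendsto_add_at_top[OF tendsto_const lim])
  then have "filterlim (\<lambda>t. - w t) at_top at_top"
  proof (rule filterlim_at_top_mono)
    show "\<forall>\<^sub>F t in at_top. - (w t0 + g t0) + g t \<le> - w t"
      using eventually_ge_at_top[of t0] by eventually_elim (use t0 in force)
  qed
  then show ?thesis by (simp add: filterlim_uminus_at_bot)
qed

lemma tendsto_real_not_at_bot:
  fixes w :: "real \<Rightarrow> real"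
  assumes "(w \<longlongrightarrow> r) at_top" "filterlim w at_bot at_top"
  shows False
  using not_tendsto_and_filterlim_at_infinity[OF _ assms(1)]
    filterlim_at_bot_imp_at_infinity[OF assms(2)] by auto

lemma eventually_scale:
  assumes "(c::real) > 0" "\<forall>\<^sub>F x in at_right 0. P x"
  shows "\<forall>\<^sub>F x in at_right 0. P (c * x)"
proof -
  have "filterlim (\<lambda>x. c * x) (at_right 0) (at_right 0)"
    unfolding filterlim_at using assms(1)
    by (auto intro!: tendsto_eq_intros simp: eventually_at_right_less
        intro: eventually_mono[OF eventually_at_right_less[of 0]])
  then show ?thesis using assms(2) by (simp add: filterlim_iff)
qed

lemma set_integral_deriv:
  fixes g :: "real \<Rightarrow> real"
  assumes "continuous_on {0..} g" "t > 0"
  shows "((\<lambda>t. LBINT s:{0..t}. g s) has_real_derivative g t) (at t)"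
proof -
  have cont: "continuous_on {0..u} g" for u
    by (rule continuous_on_subset[OF assms(1)]) auto
  have "(LBINT s:{0..u}. g s) = integral {0..u} g" for u
    by (rule set_borel_integral_eq_integral(2)[OF borel_integrable_atLeastAtMost'[OF cont]])
  moreover have "((\<lambda>u. integral {0..u} g) has_real_derivative g t) (at t within {0..t + 1})"
    using integral_has_real_derivative[OF cont] assms(2) by auto
  ultimately show ?thesis using assms(2) by (simp add: at_within_Icc_at)
qed

section \<open>The nonlinearity and the reference solution\<close>

locale nonlinearity =
  fixes f :: "real \<Rightarrow> real"
  assumes f_lipschitz: "local_lipschitz (UNIV :: real set) UNIV (\<lambda>_. f)"
    and f_mono: "mono f"
    and f_odd: "f (- x) = - f x"
    and f_sign: "x \<noteq> 0 \<Longrightarrow> x * f x > 0"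
    and Phi: "(Phi_low f \<longlongrightarrow> 1) (at_right 0)"
    and f_limsup: "0 < \<mu> \<Longrightarrow> \<mu> < 1 \<Longrightarrow>
                Limsup (at_right 0) (\<lambda>x. ereal (f (\<mu> * x) / f x)) < ereal \<mu>"
begin

lemma f_zero: "f 0 = 0"
  using f_odd[of 0] by simp

lemma f_pos: "x > 0 \<Longrightarrow> f x > 0"
  using f_sign[of x] by (simp add: zero_less_mult_iff)

lemma f_nonneg: "x \<ge> 0 \<Longrightarrow> f x \<ge> 0"
  using f_pos[of x] f_zero by (cases "x = 0") auto

lemma f_le: "x \<le> y \<Longrightarrow> f x \<le> f y"
  using f_mono by (rule monoD)

lemma f_cont: "continuous_on S f"
  using local_lipschitz_continuous_on[OF f_lipschitz, of 0] by (auto intro: continuous_on_subset)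

text \<open>Lipschitz continuity around 0 together with \<open>f 0 = 0\<close>. The bound makes
  \<open>1 / f\<close> non-integrable at 0, which is why \<open>F\<close> is unbounded
  there.\<close>

lemma f_linear_bound: "\<exists>K>0. \<exists>u>0. \<forall>x\<in>{0..u}. f x \<le> K * x"
proof -
  obtain u L where u: "u > 0" "\<forall>s\<in>cball (0::real) u \<inter> UNIV. L-lipschitz_on (cball 0 u \<inter> UNIV) f"
    using f_lipschitz unfolding local_lipschitz_def by blast
  then have L: "L-lipschitz_on (cball 0 u) f" using bspec[OF u(2), of 0] by simp
  have "f x \<le> (L + 1) * x" if "x \<in> {0..u}" for x
  proof -
    have "dist (f x) (f 0) \<le> L * dist x 0"
      by (rule lipschitz_onD[OF L]) (use that u in \<open>auto simp: dist_real_def\<close>)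
    then have "\<bar>f x\<bar> \<le> L * x" using that by (simp add: f_zero dist_real_def)
    then show ?thesis using that unfolding distrib_right by auto
  qed
  moreover have "L \<ge> 0" using lipschitz_on_nonneg[OF L] .
  ultimately show ?thesis using \<open>u > 0\<close> by (intro exI[of _ "L + 1"]) auto
qed

section \<open>Inequalities near 0 extracted from the two limit hypotheses\<close>

text \<open>As \<open>Phi_low f \<epsilon>\<close> tends to 1, some \<open>\<epsilon>\<close> has
  its liminf above \<open>1 - \<delta>\<close>, and the quotient then exceeds
  \<open>1 - \<delta>\<close> for all small \<open>x\<close>.\<close>

lemma f_left_stable:
  assumes "0 < \<delta>"
  shows "\<exists>\<epsilon>. 0 < \<epsilon> \<and> \<epsilon> < 1 \<and> (\<forall>\<^sub>F x in at_right 0. (1 - \<delta>) * f x \<le> f ((1 - \<epsilon>) * x))"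
proof -
  have "ereal (1 - \<delta>) < 1" using assms by (simp add: one_ereal_def)
  then have "\<forall>\<^sub>F \<epsilon> in at_right 0. ereal (1 - \<delta>) < Phi_low f \<epsilon>"
    using order_tendstoD(1)[OF Phi] by blast
  moreover have "\<forall>\<^sub>F \<epsilon> in at_right 0. \<epsilon> \<in> {0<..<1::real}"
    by (intro eventually_at_right_real) simp
  ultimately have "\<forall>\<^sub>F \<epsilon> in at_right 0. ereal (1 - \<delta>) < Phi_low f \<epsilon> \<and> \<epsilon> \<in> {0<..<1::real}"
    by eventually_elim auto
  then obtain \<epsilon> where \<epsilon>: "ereal (1 - \<delta>) < Phi_low f \<epsilon>" "0 < \<epsilon>" "\<epsilon> < 1"
    using eventually_happens'[OF trivial_limit_at_right_real] by fastforce
  have "\<forall>\<^sub>F x in at_right 0. ereal (1 - \<delta>) < ereal (f ((1 - \<epsilon>) * x) / f x)"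
    using \<epsilon>(1) unfolding Phi_low_def by (rule less_LiminfD)
  moreover have "\<forall>\<^sub>F x in at_right (0::real). x > 0"
    by (simp add: eventually_at_right_less)
  ultimately have "\<forall>\<^sub>F x in at_right 0. (1 - \<delta>) * f x \<le> f ((1 - \<epsilon>) * x)"
    by eventually_elim (use f_pos in \<open>auto simp: pos_less_divide_eq\<close>)
  with \<epsilon> show ?thesis by blast
qed

text \<open>Take a real \<open>m\<close> strictly between the limsup and \<open>\<mu>\<close>. It is
  positive because \<open>f\<close> is positive at both arguments; later proofs divide by
  it.\<close>

lemma f_superlinear:
  assumes "0 < \<mu>" "\<mu> < 1"
  shows "\<exists>m. 0 < m \<and> m < \<mu> \<and> (\<forall>\<^sub>F x in at_right 0. f (\<mu> * x) \<le> m * f x)"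
proof -
  obtain m where m: "Limsup (at_right 0) (\<lambda>x. ereal (f (\<mu> * x) / f x)) < ereal m" "ereal m < ereal \<mu>"
    using ereal_dense2[OF f_limsup[OF assms]] by blast
  have "\<forall>\<^sub>F x in at_right 0. ereal (f (\<mu> * x) / f x) < ereal m"
    using m(1) by (rule Limsup_lessD)
  moreover have ev: "\<forall>\<^sub>F x in at_right (0::real). x > 0"
    by (simp add: eventually_at_right_less)
  ultimately have *: "\<forall>\<^sub>F x in at_right 0. f (\<mu> * x) \<le> m * f x"
    by eventually_elim (use f_pos in \<open>auto simp: pos_divide_less_eq\<close>)
  obtain x where x: "x > 0" "f (\<mu> * x) \<le> m * f x"
    using eventually_happens'[OF trivial_limit_at_right_real eventually_conj[OF ev *]] by auto
  have "0 < f (\<mu> * x)" "0 < f x" using x assms by (auto intro: f_pos)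
  then have "0 < m" using x by (smt (verit) zero_less_mult_pos2)
  then show ?thesis using * m by auto
qed

text \<open>Superlinearity at \<open>a\<close> leaves room between its factor and \<open>a\<close>;
  left stability trades part of it for a larger argument. The slack in the argument later absorbs
  \<open>T / y\<close>.\<close>

lemma f_strict_below:
  assumes a: "0 < a" "a < 1"
  shows "\<exists>b m. a < b \<and> m < a \<and> (\<forall>\<^sub>F x in at_right 0. f (b * x) \<le> m * f x)"
proof -
  obtain m where m: "0 < m" "m < a" "\<forall>\<^sub>F x in at_right 0. f (a * x) \<le> m * f x"
    using f_superlinear[OF a] by blast
  define n where "n = (m + a) / 2"
  have n: "m < n" "n < a" "n > 0" using m by (auto simp: n_def)
  \<comment> \<open>Here \<open>1 - \<delta> = m / n\<close>, so moving the argument from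
    \<open>a * x\<close> up to \<open>?b * x\<close> turns the factor \<open>m\<close> into
    \<open>n\<close>, still below \<open>a\<close>.\<close>
  define \<delta> where "\<delta> = 1 - m / n"
  have \<delta>: "0 < \<delta>" "\<delta> < 1" using n m by (auto simp: \<delta>_def)
  obtain \<epsilon> where \<epsilon>: "0 < \<epsilon>" "\<epsilon> < 1" "\<forall>\<^sub>F x in at_right 0. (1 - \<delta>) * f x \<le> f ((1 - \<epsilon>) * x)"
    using f_left_stable[OF \<delta>(1)] by blast
  let ?b = "a / (1 - \<epsilon>)"
  have b: "?b > a" using \<epsilon> a by (simp add: field_simps)
  have "\<forall>\<^sub>F x in at_right 0. (1 - \<delta>) * f (?b * x) \<le> f ((1 - \<epsilon>) * (?b * x))"
    by (rule eventually_scale) (use \<epsilon> a in auto)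
  with m(3) have "\<forall>\<^sub>F x in at_right 0. f (?b * x) \<le> n * f x"
  proof eventually_elim
    case (elim x)
    have "(1 - \<epsilon>) * (?b * x) = a * x" using \<epsilon> by simp
    then have "(m / n) * f (?b * x) \<le> m * f x" using elim by (simp add: \<delta>_def)
    then show ?case using m n by (simp add: field_simps)
  qed
  with b n show ?thesis by blast
qed

text \<open>Superlinearity for \<open>1 / a\<close>, read at the point \<open>a * x\<close>, bounds
  \<open>f (a * x) / f x\<close> below by a number above \<open>a\<close>; left stability then
  lowers the argument and keeps the factor above \<open>a\<close>.\<close>

lemma f_strict_above:
  assumes a: "1 < a"
  shows "\<exists>b m. b < a \<and> a < m \<and> (\<forall>\<^sub>F x in at_right 0. m * f x \<le> f (b * x))"
proof -
  obtain m where m: "0 < m" "m < 1 / a" "\<forall>\<^sub>F x in at_right 0. f (1 / a * x) \<le> m * f x"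
    using f_superlinear[of "1 / a"] a by auto
  have m': "a < 1 / m" using m a by (simp add: field_simps)
  define n where "n = (a + 1 / m) / 2"
  have n: "a < n" "n < 1 / m" using m' by (auto simp: n_def field_simps)
  \<comment> \<open>The loss \<open>1 - \<delta> = n * m\<close> turns the factor
    \<open>1 / m\<close> into \<open>n\<close>.\<close>
  define \<delta> where "\<delta> = 1 - n * m"
  have \<delta>: "0 < \<delta>" using n m by (simp add: \<delta>_def field_simps)
  obtain \<epsilon> where \<epsilon>: "0 < \<epsilon>" "\<epsilon> < 1" "\<forall>\<^sub>F x in at_right 0. (1 - \<delta>) * f x \<le> f ((1 - \<epsilon>) * x)"
    using f_left_stable[OF \<delta>] by blast
  have b: "(1 - \<epsilon>) * a < a" using \<epsilon> a by (simp add: field_simps)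
  have "\<forall>\<^sub>F x in at_right 0. f (1 / a * (a * x)) \<le> m * f (a * x)"
    by (rule eventually_scale) (use a m in auto)
  moreover have "\<forall>\<^sub>F x in at_right 0. (1 - \<delta>) * f (a * x) \<le> f ((1 - \<epsilon>) * (a * x))"
    by (rule eventually_scale) (use a \<epsilon> in auto)
  ultimately have "\<forall>\<^sub>F x in at_right 0. n * f x \<le> f ((1 - \<epsilon>) * a * x)"
  proof eventually_elim
    case (elim x)
    have "f x \<le> m * f (a * x)" using elim(1) a by simp
    then have "n * f x \<le> n * (m * f (a * x))" using n a by (intro mult_left_mono) auto
    also have "\<dots> \<le> f ((1 - \<epsilon>) * a * x)" using elim(2) by (simp add: \<delta>_def mult_ac)
    finally show ?case .
  qed
  with b n show ?thesis by blast
qed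

text \<open>The point is uniformity in \<open>l\<close>. Iterating the case
  \<open>\<mu> = 1 / 2\<close> gives \<open>f (x / 2 ^ n) \<le> m ^ n * f x\<close> with
  \<open>2 * m < 1\<close>, so relative to the dyadic scale of \<open>l\<close> the bound decays
  geometrically.\<close>

lemma f_far_below:
  "\<exists>K\<ge>1. \<forall>\<^sub>F x in at_right 0. \<forall>l. 0 < l \<and> l \<le> 1 / K \<longrightarrow> f (l * x) \<le> l / 2 * f x"
proof -
  obtain m where m: "0 < m" "m < 1 / 2" "\<forall>\<^sub>F x in at_right 0. f (1 / 2 * x) \<le> m * f x"
    using f_superlinear[of "1 / 2"] by auto
  then obtain x0 where x0: "x0 > 0" "\<And>x. 0 < x \<Longrightarrow> x < x0 \<Longrightarrow> f (x / 2) \<le> m * f x"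
    by (auto simp: eventually_at_right_field)
  have iter: "f (x / 2 ^ n) \<le> m ^ n * f x" if "0 < x" "x < x0" for x n
  proof (induction n)
    case (Suc n)
    have "x / 2 ^ n \<le> x" using that by (simp add: field_simps)
    then have "f (x / 2 ^ n / 2) \<le> m * f (x / 2 ^ n)"
      by (intro x0(2)) (use that in auto)
    also have "\<dots> \<le> m * (m ^ n * f x)" using Suc m by (intro mult_left_mono) auto
    finally show ?case by (simp add: mult_ac)
  qed simp
  \<comment> \<open>The factor 1/4 pays for a loss of 2 in rounding \<open>l\<close> to a power of 2
    and for the 2 in \<open>l / 2\<close>.\<close>
  obtain k where k: "(2 * m) ^ k < 1 / 4"
    using real_arch_pow_inv[of "1/4" "2 * m"] m by auto
  have "f (l * x) \<le> l / 2 * f x" if x: "0 < x" "x < x0" and l: "0 < l" "l \<le> 1 / 2 ^ k" for x l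
  proof -
    have ex: "\<exists>n. 1 / 2 ^ Suc n < l"
    proof -
      obtain n where "(1 / 2) ^ n < l" using real_arch_pow_inv[of l "1 / 2"] l by auto
      moreover have "(1::real) / 2 ^ Suc n \<le> (1 / 2) ^ n" by (simp add: power_one_over field_simps)
      ultimately show ?thesis by (intro exI[of _ n]) linarith
    qed
    \<comment> \<open>The dyadic scale of \<open>l\<close>, with
      \<open>1 / 2 ^ Suc n < l \<le> 1 / 2 ^ n\<close>; smallness of \<open>l\<close> yields
      \<open>k \<le> n\<close>.\<close>
    define n where "n = (LEAST n. 1 / 2 ^ Suc n < l)"
    have n1: "1 / 2 ^ Suc n < l" unfolding n_def using ex by (rule LeastI_ex)
    have nk: "k \<le> n"
    proof (rule ccontr)
      assume "\<not> k \<le> n"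
      then have "Suc n \<le> k" by simp
      then have "(2::real) ^ Suc n \<le> 2 ^ k" by (intro power_increasing) auto
      then have "1 / (2::real) ^ k \<le> 1 / 2 ^ Suc n" by (intro divide_left_mono) auto
      with n1 l show False by linarith
    qed
    have n2: "l \<le> 1 / 2 ^ n"
    proof (cases n)
      case 0
      have "1 / (2::real) ^ k \<le> 1" by simp
      with l(2) have "l \<le> 1" by (rule order_trans)
      with 0 show ?thesis by simp
    next
      case (Suc j)
      then have "\<not> 1 / 2 ^ Suc j < l" unfolding n_def by (intro not_less_Least) auto
      then show ?thesis using Suc by simp
    qed
    have "f (l * x) \<le> f (x / 2 ^ n)"
      by (rule f_le) (use n2 x mult_right_mono[OF n2, of x] in simp)
    also have "\<dots> \<le> m ^ n * f x" by (rule iter[OF x])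
    also have "m ^ n = (2 * m) ^ n * (2 * (1 / 2 ^ Suc n))"
      by (simp add: power_mult_distrib)
    also have "\<dots> \<le> (2 * m) ^ k * (2 * l)"
      using n1 nk m by (intro mult_mono power_decreasing) auto
    also have "\<dots> \<le> 1 / 4 * (2 * l)"
      using k l by (intro mult_right_mono) auto
    finally show ?thesis using f_pos[of x] x by (simp add: mult_right_mono)
  qed
  then show ?thesis
    using x0(1) by (intro exI[of _ "2 ^ k"]) (auto simp: eventually_at_right_field)
qed

section \<open>The function \<open>F\<close> and its inverse\<close>

lemma F_deriv:
  assumes "x > 0"
  shows "(F f has_real_derivative - (1 / f x)) (at x)"
proof -
  \<comment> \<open>A compact interval of positive numbers that contains the base point 1 and has
    \<open>x\<close> in its interior.\<close>
  define a b where "a = min (x / 2) (1 / 2)" and "b = max (x + 1) 2"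
  have ab: "0 < a" "a < x" "x < b" "a \<le> 1" "1 \<le> b" using assms by (auto simp: a_def b_def)
  have "((\<lambda>u. LBINT y=ereal 1..ereal u. 1 / f y) has_vector_derivative 1 / f x) (at x within {a..b})"
  proof (rule interval_integral_FTC2)
    have "f z \<noteq> 0" if "z \<in> {a..b}" for z using f_pos[of z] ab that by auto
    then show "continuous_on {a..b} (\<lambda>y. 1 / f y)"
      by (intro continuous_on_divide f_cont continuous_on_const) blast
  qed (use ab in auto)
  then have "((\<lambda>u. LBINT y=ereal 1..ereal u. 1 / f y) has_real_derivative 1 / f x) (at x)"
    using ab by (simp add: has_real_derivative_iff_has_vector_derivative at_within_Icc_at)
  then have "((\<lambda>u. - (LBINT y=ereal 1..ereal u. 1 / f y)) has_real_derivative - (1 / f x)) (at x)"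
    by (rule DERIV_minus)
  moreover have "F f = (\<lambda>u. - (LBINT y=ereal 1..ereal u. 1 / f y))"
    unfolding F_def using interval_integral_endpoints_reverse by fastforce
  ultimately show ?thesis by simp
qed

lemma F_one: "F f 1 = 0"
  unfolding F_def by simp

lemma F_strict: "0 < x \<Longrightarrow> x < y \<Longrightarrow> F f y < F f x"
proof (rule DERIV_neg_imp_decreasing[of x y])
  fix z assume "0 < x" "x \<le> z"
  then have "z > 0" by simp
  then show "\<exists>d. (F f has_real_derivative d) (at z) \<and> d < 0"
    using F_deriv[of z] f_pos[of z] by (intro exI[of _ "- (1 / f z)"]) auto
qed

text \<open>Near 0, \<open>f z \<le> K * z\<close> makes \<open>F f z + ln z / K\<close>
  nonincreasing, so \<open>F\<close> grows at least like \<open>- ln z / K\<close>.\<close>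

lemma F_unbounded: "\<exists>x. 0 < x \<and> x \<le> 1 \<and> t \<le> F f x"
proof -
  obtain K u0 where K: "K > 0" "u0 > 0" "\<And>x. x \<in> {0..u0} \<Longrightarrow> f x \<le> K * x"
    using f_linear_bound by blast
  define u where "u = min u0 1"
  have u: "0 < u" "u \<le> 1" "u \<le> u0" using K by (auto simp: u_def)
  \<comment> \<open>Chosen so that \<open>ln x / K \<le> F f u + ln u / K - t\<close>; monotonicity
    then gives \<open>t \<le> F f x\<close>.\<close>
  define x where "x = min u (exp (K * (F f u + ln u / K - t)))"
  have x: "0 < x" "x \<le> u" using u by (auto simp: x_def)
  have "F f u + ln u / K \<le> F f x + ln x / K"
  proof (rule DERIV_nonpos_imp_nonincreasing[OF x(2)])
    fix z assume z: "x \<le> z" "z \<le> u"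
    then have z0: "z > 0" using x by simp
    have "((\<lambda>z. F f z + ln z / K) has_real_derivative - (1 / f z) + 1 / z / K) (at z)"
      using z0 K(1) by (auto intro!: DERIV_add F_deriv DERIV_cdivide derivative_eq_intros)
    moreover have "1 / (K * z) \<le> 1 / f z"
      using K(1) K(3)[of z] z z0 u f_pos[OF z0] by (intro divide_left_mono) auto
    ultimately show "\<exists>y. ((\<lambda>z. F f z + ln z / K) has_real_derivative y) (at z) \<and> y \<le> 0"
      by (intro exI[of _ "- (1 / f z) + 1 / z / K"]) (auto simp: mult.commute)
  qed
  moreover have "ln x \<le> K * (F f u + ln u / K - t)"
    using x ln_le_cancel_iff[of x "exp (K * (F f u + ln u / K - t))"] by (simp add: x_def)
  then have "ln x / K \<le> F f u + ln u / K - t" using K by (simp add: pos_divide_le_eq mult.commute)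
  ultimately have "t \<le> F f x" by linarith
  then show ?thesis using x u by force
qed

lemma F_inv_props:
  assumes "t \<ge> 0"
  shows "F_inv f t > 0" "F f (F_inv f t) = t"
proof -
  obtain x where x: "0 < x" "x \<le> 1" "t \<le> F f x" using F_unbounded by blast
  have "\<exists>z. x \<le> z \<and> z \<le> 1 \<and> F f z = t"
    using x assms F_one DERIV_isCont[OF F_deriv] by (intro IVT2) auto
  then have "t \<in> F f ` {0<..}" using x by force
  then show "F_inv f t > 0" "F f (F_inv f t) = t"
    unfolding F_inv_def using inv_into_into[of t "F f" "{0<..}"] by (auto intro: f_inv_into_f)
qed

lemma F_inv_F: "x > 0 \<Longrightarrow> F_inv f (F f x) = x"
  unfolding F_inv_def
  by (rule inv_into_f_f) (auto intro!: linorder_inj_onI dest: F_strict)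

lemma F_inv_deriv:
  assumes "t > 0"
  shows "(F_inv f has_real_derivative - f (F_inv f t)) (at t)"
proof -
  let ?y = "F_inv f t"
  have y: "?y > 0" "F f ?y = t" using F_inv_props[of t] assms by auto
  have "isCont (F_inv f) (F f ?y)"
    by (rule isCont_inverse_function2[of "?y / 2" _ "?y + 1"])
      (use y in \<open>auto intro!: F_inv_F DERIV_isCont[OF F_deriv]\<close>)
  then have "(F_inv f has_real_derivative inverse (- (1 / f ?y))) (at t)"
    using y f_pos[OF y(1)] assms
    by (intro DERIV_inverse_function[of "F f" _ _ _ 0 "t + 1"]) (auto intro!: F_deriv F_inv_props)
  then show ?thesis using y by simp
qed

lemma F_inv_tendsto_0: "filterlim (F_inv f) (at_right 0) at_top"
proof -
  have pos: "\<forall>\<^sub>F t in at_top. F_inv f t > 0"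
    using eventually_ge_at_top[of 0] by eventually_elim (rule F_inv_props)
  have "(F_inv f \<longlongrightarrow> 0) at_top"
  proof (rule order_tendstoI)
    fix e :: real assume "0 < e"
    have "\<forall>\<^sub>F t in at_top. t \<ge> 0 \<and> t > F f e"
      by (intro eventually_conj eventually_ge_at_top eventually_gt_at_top)
    then show "\<forall>\<^sub>F t in at_top. F_inv f t < e"
    proof eventually_elim
      case (elim t)
      then show ?case using F_inv_props[of t] F_strict[OF \<open>0 < e\<close>, of "F_inv f t"]
        by (cases "F_inv f t" e rule: linorder_cases) auto
    qed
  qed (use pos in \<open>auto elim: eventually_mono\<close>)
  then show ?thesis using pos by (auto simp: filterlim_at elim: eventually_mono)
qed

lemma eventually_F_inv:
  "\<forall>\<^sub>F x in at_right 0. P x \<Longrightarrow> \<forall>\<^sub>F t in at_top. P (F_inv f t)"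
  using F_inv_tendsto_0 by (simp add: filterlim_iff)

end

section \<open>Perturbations of the reference solution\<close>

context nonlinearity
begin

abbreviation y :: "real \<Rightarrow> real" where "y \<equiv> F_inv f"

text \<open>To be read with \<open>Z = X + T\<close>, where \<open>X\<close> is a path and
  \<open>T\<close> the tail of its noise. Only \<open>Z\<close> is differentiated; \<open>T\<close>
  may be rough and is merely small against \<open>y\<close>.\<close>

definition perturbed :: "(real \<Rightarrow> real) \<Rightarrow> (real \<Rightarrow> real) \<Rightarrow> bool" where
  "perturbed Z T \<longleftrightarrow>
     (\<forall>t>0. (Z has_real_derivative - f (Z t - T t)) (at t)) \<and> ((\<lambda>t. T t / y t) \<longlongrightarrow> 0) at_top"

text \<open>Oddness of \<open>f\<close>; it reduces negative levels and limits to positive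
  ones.\<close>

lemma perturbed_uminus: "perturbed Z T \<Longrightarrow> perturbed (\<lambda>t. - Z t) (\<lambda>t. - T t)"
proof -
  assume p: "perturbed Z T"
  have "((\<lambda>t. - Z t) has_real_derivative - f (- Z t - - T t)) (at t)" if "t > 0" for t
  proof -
    have "- f (- Z t - - T t) = - (- f (Z t - T t))" using f_odd[of "Z t - T t"] by (simp add: algebra_simps)
    moreover have "((\<lambda>t. - Z t) has_real_derivative - (- f (Z t - T t))) (at t)"
      using p that by (intro DERIV_minus) (auto simp: perturbed_def)
    ultimately show ?thesis by metis
  qed
  moreover have "((\<lambda>t. - T t / y t) \<longlongrightarrow> - 0) at_top"
    using p unfolding perturbed_def minus_divide_left[symmetric] by (intro tendsto_minus) auto
  ultimately show ?thesis by (simp add: perturbed_def)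
qed

lemma ev_y_pos: "\<forall>\<^sub>F t in at_top. y t > 0"
  using eventually_ge_at_top[of 0] by eventually_elim (rule F_inv_props)

lemma perturbation_tendsto_0:
  assumes "perturbed Z T"
  shows "(T \<longlongrightarrow> 0) at_top"
proof -
  have "((\<lambda>t. T t / y t * y t) \<longlongrightarrow> 0 * 0) at_top"
    using assms F_inv_tendsto_0 by (intro tendsto_mult) (auto simp: perturbed_def filterlim_at)
  moreover have "\<forall>\<^sub>F t in at_top. T t / y t * y t = T t"
    using ev_y_pos by eventually_elim auto
  ultimately show ?thesis using tendsto_cong[of "\<lambda>t. T t / y t * y t" T at_top 0] by simp
qed

text \<open>Once \<open>T\<close> is below \<open>\<delta> / 2\<close> in absolute value, the drift
  is at most \<open>- f (\<delta> / 2)\<close> wherever \<open>Z\<close> is at least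
  \<open>\<delta>\<close>. This bounds \<open>Z\<close> above by small numbers, so that estimates on
  \<open>f\<close> near 0 apply, before anything is known about \<open>Z / y\<close>.\<close>

lemma perturbed_eventually_less:
  assumes p: "perturbed Z T" and "\<delta> > 0"
  shows "\<forall>\<^sub>F t in at_top. Z t < \<delta>"
proof -
  have deriv: "\<And>t. t > 0 \<Longrightarrow> (Z has_real_derivative - f (Z t - T t)) (at t)"
    using p by (auto simp: perturbed_def)
  have T: "\<forall>\<^sub>F t in at_top. \<bar>T t\<bar> < \<delta> / 2"
    using order_tendstoD(2)[OF tendsto_rabs_zero[OF perturbation_tendsto_0[OF p]], of "\<delta>/2"] \<open>\<delta> > 0\<close>
    by simp
  have down: "\<forall>\<^sub>F t in at_top. Z t \<ge> \<delta> \<longrightarrow> - f (Z t - T t) \<le> - f (\<delta> / 2)"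
    using T by eventually_elim (auto intro!: f_le)
  have "f (\<delta> / 2) > 0" using \<open>\<delta> > 0\<close> by (intro f_pos) auto
  then have "\<forall>\<^sub>F t in at_top. Z t = \<delta> \<longrightarrow> - f (Z t - T t) < 0"
    using down by (auto elim: eventually_mono)
  from barrier_dichotomy[OF deriv this] show ?thesis
  proof
    \<comment> \<open>Remaining above \<open>\<delta>\<close> would drive \<open>Z\<close> to minus
      infinity, which yields the claim all the same; the other alternative is the claim
      itself.\<close>
    assume gt: "\<forall>\<^sub>F t in at_top. Z t > \<delta>"
    have "filterlim Z at_bot at_top"
    proof (rule drift_to_bot[OF deriv])
      show "((\<lambda>t. f (\<delta> / 2) * t) has_real_derivative f (\<delta> / 2)) (at t)" for t
        by (auto intro!: derivative_eq_intros)
      show "\<forall>\<^sub>F t in at_top. - f (Z t - T t) \<le> - f (\<delta> / 2)"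
        using gt down by eventually_elim auto
      show "LIM t at_top. f (\<delta> / 2) * t :> at_top"
        using \<open>f (\<delta> / 2) > 0\<close> by (intro filterlim_tendsto_pos_mult_at_top[OF tendsto_const]) (auto simp: filterlim_ident)
    qed
    then have "\<forall>\<^sub>F t in at_top. Z t < \<delta>"
      unfolding filterlim_at_bot_dense by blast
    then show ?thesis .
  qed
qed

section \<open>Drift of the ratio near a fixed level\<close>

text \<open>Quotient rule for \<open>Z / y\<close> with \<open>y' = - f y\<close>, factored so that
  the bracket carries the sign and the first factor is the rate \<open>- (ln y)'\<close>.\<close>

definition ratio_drift :: "(real \<Rightarrow> real) \<Rightarrow> (real \<Rightarrow> real) \<Rightarrow> real \<Rightarrow> real" where
  "ratio_drift Z T t = f (y t) / y t * (Z t / y t - f (Z t - T t) / f (y t))"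

lemma ratio_deriv:
  assumes "perturbed Z T" "t > 0"
  shows "((\<lambda>t. Z t / y t) has_real_derivative ratio_drift Z T t) (at t)"
proof -
  have y: "y t > 0" "f (y t) > 0" using F_inv_props(1)[of t] assms(2) f_pos by auto
  have "((\<lambda>t. Z t / y t) has_real_derivative
      ((- f (Z t - T t)) * y t - Z t * (- f (y t))) / (y t * y t)) (at t)"
    using y assms F_inv_deriv by (intro DERIV_divide) (auto simp: perturbed_def)
  also have "((- f (Z t - T t)) * y t - Z t * (- f (y t))) / (y t * y t) = ratio_drift Z T t"
    using y by (simp add: ratio_drift_def field_simps)
  finally show ?thesis .
qed

lemma ratio_drift_scaled:
  assumes "t \<ge> 0"
  shows "ratio_drift Z T t = f (y t) / y t * (Z t / y t - f ((Z t / y t - T t / y t) * y t) / f (y t))"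
  using F_inv_props(1)[OF assms] by (simp add: ratio_drift_def left_diff_distrib)

text \<open>The room \<open>b < a < m\<close> of \<open>f_strict_above\<close> absorbs both the
  deviation of the ratio from \<open>a\<close> and \<open>T / y\<close>. The sign at
  \<open>a\<close> itself gives the barrier; the neighbourhood and the rate serve to exclude
  \<open>a\<close> as a limit.\<close>

lemma drift_above_one:
  assumes p: "perturbed Z T" and a: "1 < a"
  shows "\<exists>\<epsilon>>0. \<exists>c>0. \<forall>\<^sub>F t in at_top. \<bar>Z t / y t - a\<bar> < \<epsilon> \<longrightarrow> ratio_drift Z T t \<le> - (c * (f (y t) / y t))"
proof -
  obtain b m where bm: "b < a" "a < m" "\<forall>\<^sub>F x in at_right 0. m * f x \<le> f (b * x)"
    using f_strict_above[OF a] by blast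
  \<comment> \<open>Half of \<open>a - b\<close> is left to the ratio and half to
    \<open>T / y\<close>; half of \<open>m - a\<close> survives as the constant
    \<open>c\<close>.\<close>
  define \<epsilon> where "\<epsilon> = min ((a - b) / 2) ((m - a) / 2)"
  have \<epsilon>: "\<epsilon> > 0" "\<epsilon> \<le> (a - b) / 2" "\<epsilon> \<le> (m - a) / 2" using bm by (auto simp: \<epsilon>_def min_def field_simps)
  have "((\<lambda>t. \<bar>T t / y t\<bar>) \<longlongrightarrow> 0) at_top"
    using p by (intro tendsto_rabs_zero) (auto simp: perturbed_def)
  then have "\<forall>\<^sub>F t in at_top. \<bar>T t / y t\<bar> < (a - b) / 2"
    by (rule order_tendstoD) (use bm in auto)
  moreover note eventually_F_inv[OF bm(3)] eventually_ge_at_top[of 0]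
  ultimately have "\<forall>\<^sub>F t in at_top. \<bar>Z t / y t - a\<bar> < \<epsilon> \<longrightarrow>
      ratio_drift Z T t \<le> - ((m - a) / 2 * (f (y t) / y t))"
  proof eventually_elim
    case (elim t)
    show ?case
    proof
      assume near: "\<bar>Z t / y t - a\<bar> < \<epsilon>"
      let ?w = "Z t / y t"
      have y: "y t > 0" "f (y t) > 0" using F_inv_props(1)[of t] elim f_pos by auto
      have aux: "b \<le> u - e" if "\<bar>u - a\<bar> < \<epsilon>" "\<bar>e\<bar> < (a - b) / 2" "\<epsilon> \<le> (a - b) / 2" for u e
        using that by (auto simp: abs_less_iff field_simps)
      have "b \<le> ?w - T t / y t" using near elim(1) \<epsilon>(2) aux by blast
      then have "f (b * y t) \<le> f ((?w - T t / y t) * y t)"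
        using y by (intro f_le mult_right_mono) auto
      then have "m \<le> f ((?w - T t / y t) * y t) / f (y t)"
        using elim(2) y by (simp add: pos_le_divide_eq)
      moreover have aux': "u - r \<le> - ((m - a) / 2)"
        if "m \<le> r" "\<bar>u - a\<bar> < \<epsilon>" "\<epsilon> \<le> (m - a) / 2" for u r
        using that by (auto simp: abs_less_iff field_simps)
      ultimately have "?w - f ((?w - T t / y t) * y t) / f (y t) \<le> - ((m - a) / 2)"
        using near \<epsilon>(3) aux' by blast
      then have "f (y t) / y t * (?w - f ((?w - T t / y t) * y t) / f (y t))
          \<le> f (y t) / y t * (- ((m - a) / 2))"
        using y by (intro mult_left_mono) auto
      then show "ratio_drift Z T t \<le> - ((m - a) / 2 * (f (y t) / y t))"
        using elim by (simp add: ratio_drift_scaled mult.commute)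
    qed
  qed
  moreover have "(m - a) / 2 > 0" using bm by simp
  ultimately show ?thesis using \<epsilon> by blast
qed

text \<open>Mirror image of \<open>drift_above_one\<close>, based on \<open>f_strict_below\<close>:
  between 0 and 1 the ratio is pushed upwards.\<close>

lemma drift_below_one:
  assumes p: "perturbed Z T" and a: "0 < a" "a < 1"
  shows "\<exists>\<epsilon>>0. \<exists>c>0. \<forall>\<^sub>F t in at_top. \<bar>Z t / y t - a\<bar> < \<epsilon> \<longrightarrow> c * (f (y t) / y t) \<le> ratio_drift Z T t"
proof -
  obtain b m where bm: "a < b" "m < a" "\<forall>\<^sub>F x in at_right 0. f (b * x) \<le> m * f x"
    using f_strict_below[OF a] by blast
  define \<epsilon> where "\<epsilon> = min ((b - a) / 2) ((a - m) / 2)"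
  have \<epsilon>: "\<epsilon> > 0" "\<epsilon> \<le> (b - a) / 2" "\<epsilon> \<le> (a - m) / 2" using bm by (auto simp: \<epsilon>_def min_def field_simps)
  have "((\<lambda>t. \<bar>T t / y t\<bar>) \<longlongrightarrow> 0) at_top"
    using p by (intro tendsto_rabs_zero) (auto simp: perturbed_def)
  then have "\<forall>\<^sub>F t in at_top. \<bar>T t / y t\<bar> < (b - a) / 2"
    by (rule order_tendstoD) (use bm in auto)
  moreover note eventually_F_inv[OF bm(3)] eventually_ge_at_top[of 0]
  ultimately have "\<forall>\<^sub>F t in at_top. \<bar>Z t / y t - a\<bar> < \<epsilon> \<longrightarrow>
      (a - m) / 2 * (f (y t) / y t) \<le> ratio_drift Z T t"
  proof eventually_elim
    case (elim t)
    show ?case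
    proof
      assume near: "\<bar>Z t / y t - a\<bar> < \<epsilon>"
      let ?w = "Z t / y t"
      have y: "y t > 0" "f (y t) > 0" using F_inv_props(1)[of t] elim f_pos by auto
      have aux: "u - e \<le> b" if "\<bar>u - a\<bar> < \<epsilon>" "\<bar>e\<bar> < (b - a) / 2" "\<epsilon> \<le> (b - a) / 2" for u e
        using that by (auto simp: abs_less_iff field_simps)
      have "?w - T t / y t \<le> b" using near elim(1) \<epsilon>(2) aux by blast
      then have "f ((?w - T t / y t) * y t) \<le> f (b * y t)"
        using y by (intro f_le mult_right_mono) auto
      then have "f ((?w - T t / y t) * y t) / f (y t) \<le> m"
        using elim(2) y by (simp add: pos_divide_le_eq)
      moreover have aux': "(a - m) / 2 \<le> u - r"
        if "r \<le> m" "\<bar>u - a\<bar> < \<epsilon>" "\<epsilon> \<le> (a - m) / 2" for u r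
        using that by (auto simp: abs_less_iff field_simps)
      ultimately have "(a - m) / 2 \<le> ?w - f ((?w - T t / y t) * y t) / f (y t)"
        using near \<epsilon>(3) aux' by blast
      then have "f (y t) / y t * ((a - m) / 2)
          \<le> f (y t) / y t * (?w - f ((?w - T t / y t) * y t) / f (y t))"
        using y by (intro mult_left_mono) auto
      then show "(a - m) / 2 * (f (y t) / y t) \<le> ratio_drift Z T t"
        using elim by (simp add: ratio_drift_scaled mult.commute)
    qed
  qed
  moreover have "(a - m) / 2 > 0" using bm by simp
  ultimately show ?thesis using \<epsilon> by blast
qed

lemma ev_rate_pos: "c > 0 \<Longrightarrow> \<forall>\<^sub>F t in at_top. c * (f (y t) / y t) > 0"
  using ev_y_pos by eventually_elim (auto intro!: mult_pos_pos divide_pos_pos f_pos)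

lemma ratio_dichotomy_pos:
  assumes p: "perturbed Z T" and a: "0 < a" "a \<noteq> 1"
  shows "(\<forall>\<^sub>F t in at_top. Z t / y t < a) \<or> (\<forall>\<^sub>F t in at_top. Z t / y t > a)"
proof (cases "a > 1")
  case True
  obtain \<epsilon> c where \<epsilon>: "\<epsilon> > 0" "c > 0" and
    ev: "\<forall>\<^sub>F t in at_top. \<bar>Z t / y t - a\<bar> < \<epsilon> \<longrightarrow> ratio_drift Z T t \<le> - (c * (f (y t) / y t))"
    using drift_above_one[OF p True] by blast
  have "\<forall>\<^sub>F t in at_top. Z t / y t = a \<longrightarrow> ratio_drift Z T t < 0"
    using ev ev_rate_pos[OF \<epsilon>(2)] by eventually_elim (use \<epsilon>(1) in auto)
  then show ?thesis by (intro barrier_dichotomy[OF ratio_deriv[OF p]])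
next
  case False
  then have "a < 1" using a by simp
  obtain \<epsilon> c where \<epsilon>: "\<epsilon> > 0" "c > 0" and
    ev: "\<forall>\<^sub>F t in at_top. \<bar>Z t / y t - a\<bar> < \<epsilon> \<longrightarrow> c * (f (y t) / y t) \<le> ratio_drift Z T t"
    using drift_below_one[OF p a(1) \<open>a < 1\<close>] by blast
  \<comment> \<open>Below 1 the ratio increases through the level, so the barrier is applied to its
    negative.\<close>
  have "\<forall>\<^sub>F t in at_top. - (Z t / y t) = - a \<longrightarrow> - ratio_drift Z T t < 0"
    using ev ev_rate_pos[OF \<epsilon>(2)] by eventually_elim (use \<epsilon>(1) in auto)
  from barrier_dichotomy[OF DERIV_minus[OF ratio_deriv[OF p]] this] show ?thesis by auto
qed

lemma ratio_dichotomy: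
  assumes p: "perturbed Z T" and a: "a \<notin> {-1, 0, 1}"
  shows "(\<forall>\<^sub>F t in at_top. Z t / y t < a) \<or> (\<forall>\<^sub>F t in at_top. Z t / y t > a)"
proof (cases "a > 0")
  case True
  then show ?thesis using ratio_dichotomy_pos[OF p] a by auto
next
  case False
  then have "0 < - a" "- a \<noteq> 1" using a by auto
  from ratio_dichotomy_pos[OF perturbed_uminus[OF p] this] show ?thesis by auto
qed

text \<open>This supplies the diverging antiderivative of the rate \<open>c * (f y / y)\<close> for
  \<open>drift_to_bot\<close>.\<close>

lemma neg_ln_y_at_top:
  assumes "c > 0"
  shows "LIM t at_top. - (c * ln (y t)) :> at_top"
proof -
  have "LIM t at_top. ln (y t) :> at_bot"
    by (rule filterlim_compose[OF ln_at_0 F_inv_tendsto_0])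
  then have "LIM t at_top. - ln (y t) :> at_top" by (simp add: filterlim_uminus_at_bot)
  then have "LIM t at_top. c * - ln (y t) :> at_top"
    using assms by (intro filterlim_tendsto_pos_mult_at_top[OF tendsto_const])
  then show ?thesis by simp
qed

lemma neg_ln_y_deriv:
  assumes "t > 0"
  shows "((\<lambda>t. - (c * ln (y t))) has_real_derivative c * (f (y t) / y t)) (at t)"
proof -
  have y: "y t > 0" using F_inv_props(1)[of t] assms by auto
  show ?thesis
    by (rule derivative_eq_intros F_inv_deriv assms y refl)+ (use y in \<open>simp add: field_simps\<close>)
qed

text \<open>Near such a limit the drift would keep one sign with size at least
  \<open>c * (f y / y)\<close>, and the ratio would diverge.\<close>

lemma ratio_not_tendsto_pos:
  assumes p: "perturbed Z T" and a: "0 < a" "a \<noteq> 1"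
  shows "\<not> ((\<lambda>t. Z t / y t) \<longlongrightarrow> a) at_top"
proof
  assume lim: "((\<lambda>t. Z t / y t) \<longlongrightarrow> a) at_top"
  then have near: "\<forall>\<^sub>F t in at_top. \<bar>Z t / y t - a\<bar> < \<epsilon>" if "\<epsilon> > 0" for \<epsilon>
    using tendstoD[OF lim that] by (simp add: dist_real_def)
  show False
  proof (cases "a > 1")
    case True
    obtain \<epsilon> c where \<epsilon>: "\<epsilon> > 0" "c > 0" and
      ev: "\<forall>\<^sub>F t in at_top. \<bar>Z t / y t - a\<bar> < \<epsilon> \<longrightarrow> ratio_drift Z T t \<le> - (c * (f (y t) / y t))"
      using drift_above_one[OF p True] by blast
    have "\<forall>\<^sub>F t in at_top. ratio_drift Z T t \<le> - (c * (f (y t) / y t))"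
      using ev near[OF \<epsilon>(1)] by eventually_elim auto
    from drift_to_bot[OF ratio_deriv[OF p] neg_ln_y_deriv this neg_ln_y_at_top] \<epsilon>
    show False using tendsto_real_not_at_bot[OF lim] by auto
  next
    case False
    then have "a < 1" using a by simp
    obtain \<epsilon> c where \<epsilon>: "\<epsilon> > 0" "c > 0" and
      ev: "\<forall>\<^sub>F t in at_top. \<bar>Z t / y t - a\<bar> < \<epsilon> \<longrightarrow> c * (f (y t) / y t) \<le> ratio_drift Z T t"
      using drift_below_one[OF p a(1) \<open>a < 1\<close>] by blast
    have "\<forall>\<^sub>F t in at_top. - ratio_drift Z T t \<le> - (c * (f (y t) / y t))"
      using ev near[OF \<epsilon>(1)] by eventually_elim auto
    from drift_to_bot[OF DERIV_minus[OF ratio_deriv[OF p]] neg_ln_y_deriv this neg_ln_y_at_top] \<epsilon>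
    show False using tendsto_real_not_at_bot[OF tendsto_minus[OF lim]] by auto
  qed
qed

text \<open>Estimates at a fixed level are not uniform at high levels, so \<open>f_far_below\<close>
  is used: at late times the drift is nonpositive wherever the ratio is large, and a nonincreasing
  ratio cannot tend to infinity.\<close>

lemma ratio_not_at_top:
  assumes p: "perturbed Z T"
  shows "\<not> (LIM t at_top. Z t / y t :> at_top)"
proof
  assume lim: "LIM t at_top. Z t / y t :> at_top"
  obtain K where K: "K \<ge> 1"
    "\<forall>\<^sub>F x in at_right 0. \<forall>l. 0 < l \<and> l \<le> 1 / K \<longrightarrow> f (l * x) \<le> l / 2 * f x"
    using f_far_below by blast
  then obtain x0 where x0: "x0 > 0"
    "\<And>x l. 0 < x \<Longrightarrow> x < x0 \<Longrightarrow> 0 < l \<Longrightarrow> l \<le> 1 / K \<Longrightarrow> f (l * x) \<le> l / 2 * f x"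
    by (auto simp: eventually_at_right_field)
  have "((\<lambda>t. \<bar>T t / y t\<bar>) \<longlongrightarrow> 0) at_top"
    using p by (intro tendsto_rabs_zero) (auto simp: perturbed_def)
  then have "\<forall>\<^sub>F t in at_top. \<bar>T t / y t\<bar> < 1 / 2"
    by (rule order_tendstoD) auto
  moreover have "\<forall>\<^sub>F t in at_top. Z t / y t \<ge> 2 * K"
    using lim unfolding filterlim_at_top by blast
  moreover note perturbed_eventually_less[OF p x0(1)] eventually_ge_at_top[of 0]
  ultimately have "\<forall>\<^sub>F t in at_top. ratio_drift Z T t \<le> 0"
  proof eventually_elim
    case (elim t)
    define w where "w = Z t / y t"
    have y: "y t > 0" "f (y t) > 0" using F_inv_props(1)[of t] elim f_pos by auto
    have w: "w \<ge> 2" "w > 0" using elim(2) K(1) by (auto simp: w_def)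
    have Zw: "Z t = w * y t" using y by (simp add: w_def)
    have Z: "Z t > 0" using mult_pos_pos[OF w(2) y(1)] Zw by simp
    have "\<bar>T t\<bar> < 1 / 2 * y t" using elim(1) y by (simp add: field_simps)
    moreover have "2 * y t \<le> w * y t" using w y by (intro mult_right_mono) auto
    ultimately have "Z t / 2 \<le> Z t - T t" using Zw by (simp add: abs_less_iff)
    then have "f (Z t / 2) \<le> f (Z t - T t)" by (rule f_le)
    \<comment> \<open>Taking \<open>l = 2 / w\<close> at the point \<open>Z t / 2\<close> gives
      \<open>l * (Z t / 2) = y t\<close> and \<open>l / 2 = 1 / w\<close>; the ratio being at least
      \<open>2 * K\<close> gives \<open>l \<le> 1 / K\<close>. Halving \<open>Z\<close> made room
      for \<open>T\<close>.\<close>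
    moreover have "f (2 / w * (Z t / 2)) \<le> 2 / w / 2 * f (Z t / 2)"
      by (rule x0(2)) (use elim Z w K(1) in \<open>auto simp: w_def[symmetric] divide_simps\<close>)
    moreover have "2 / w * (Z t / 2) = y t" using w Zw by simp
    ultimately have "f (y t) \<le> 1 / w * f (Z t - T t)"
      using w mult_left_mono[of "f (Z t / 2)" "f (Z t - T t)" "1 / w"] by simp
    then have "w * f (y t) \<le> f (Z t - T t)"
      using w by (simp add: pos_le_divide_eq mult.commute)
    then have "w \<le> f (Z t - T t) / f (y t)" using y by (simp add: pos_le_divide_eq)
    then show ?case unfolding ratio_drift_def w_def
      using y by (intro mult_nonneg_nonpos) auto
  qed
  from eventually_decreasing[OF ratio_deriv[OF p] this] obtain t0
    where t0: "\<And>s t. t0 \<le> s \<Longrightarrow> s \<le> t \<Longrightarrow> Z t / y t \<le> Z s / y s" by blast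
  have "\<forall>\<^sub>F t in at_top. Z t / y t > Z t0 / y t0"
    using lim unfolding filterlim_at_top_dense by blast
  then have "\<forall>\<^sub>F t::real in at_top. False"
    using eventually_ge_at_top[of t0] by eventually_elim (use t0 in force)
  then show False by simp
qed

lemma ratio_limit:
  assumes p: "perturbed Z T"
  shows "\<exists>l\<in>{1, 0, -1}. ((\<lambda>t. Z t / y t) \<longlongrightarrow> l) at_top"
proof -
  have "\<exists>l::ereal. ((\<lambda>t. ereal (Z t / y t)) \<longlongrightarrow> l) at_top"
    by (rule ereal_limit_of_dichotomy[where S = "{-1, 0, 1}"])
      (use ratio_dichotomy[OF p] in auto)
  then obtain l :: ereal where l: "((\<lambda>t. ereal (Z t / y t)) \<longlongrightarrow> l) at_top" by blast
  show ?thesis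
  proof (cases l)
    case (real r)
    then have r: "((\<lambda>t. Z t / y t) \<longlongrightarrow> r) at_top" using l by simp
    have "r \<in> {1, 0, -1}"
    proof (rule ccontr)
      assume nr: "r \<notin> {1, 0, -1}"
      have r': "((\<lambda>t. - Z t / y t) \<longlongrightarrow> - r) at_top"
        using tendsto_minus[OF r] by simp
      show False
      proof (cases "r > 0")
        case True
        then show False using ratio_not_tendsto_pos[OF p, of r] r nr by auto
      next
        case False
        then show False using ratio_not_tendsto_pos[OF perturbed_uminus[OF p], of "- r"] r' nr by auto
      qed
    qed
    with r show ?thesis by blast
  next
    case PInf
    then have "LIM t at_top. Z t / y t :> at_top"
      using l by (simp add: tendsto_PInfty_eq_at_top)
    then show ?thesis using ratio_not_at_top[OF p] by blast
  next
    case MInf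
    then have "((\<lambda>t. - ereal (Z t / y t)) \<longlongrightarrow> \<infinity>) at_top"
      using tendsto_uminus_ereal[OF l] by simp
    then have "((\<lambda>t. ereal (- Z t / y t)) \<longlongrightarrow> \<infinity>) at_top" by simp
    then have "LIM t at_top. - Z t / y t :> at_top"
      unfolding tendsto_PInfty_eq_at_top .
    then show ?thesis using ratio_not_at_top[OF perturbed_uminus[OF p]] by blast
  qed
qed


section \<open>Asymptotics of the drift along a path comparable to \<open>y\<close>\<close>

lemma f_abs: "\<bar>f x\<bar> = f \<bar>x\<bar>"
  using f_nonneg[of x] f_nonneg[of "- x"] f_odd[of x] by (cases "x \<ge> 0") auto

text \<open>Eventually \<open>x\<close> lies between \<open>(1 - \<epsilon>) * y\<close> and
  \<open>y / (1 - \<epsilon>)\<close>; monotonicity with left stability at \<open>y\<close> and at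
  \<open>y / (1 - \<epsilon>)\<close> squeezes \<open>f x\<close>.\<close>

lemma f_ratio_tendsto_1:
  assumes lim: "((\<lambda>t. x t / y t) \<longlongrightarrow> 1) at_top"
  shows "((\<lambda>t. f (x t) / f (y t)) \<longlongrightarrow> 1) at_top"
proof (rule tendstoI)
  fix e :: real assume "e > 0"
  \<comment> \<open>Solves \<open>1 / (1 - \<delta>) = 1 + e / 2\<close>, the upper end of the
    squeeze.\<close>
  define \<delta> where "\<delta> = e / 2 / (1 + e / 2)"
  have \<delta>: "0 < \<delta>" "\<delta> < 1" "1 / (1 - \<delta>) = 1 + e / 2" "\<delta> \<le> e / 2"
    using \<open>e > 0\<close> by (auto simp: \<delta>_def field_simps)
  obtain \<epsilon> where \<epsilon>: "0 < \<epsilon>" "\<epsilon> < 1"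
    and low: "\<forall>\<^sub>F x in at_right 0. (1 - \<delta>) * f x \<le> f ((1 - \<epsilon>) * x)"
    using f_left_stable[OF \<delta>(1)] by blast
  have up: "\<forall>\<^sub>F x in at_right 0. (1 - \<delta>) * f (1 / (1 - \<epsilon>) * x) \<le> f ((1 - \<epsilon>) * (1 / (1 - \<epsilon>) * x))"
    by (rule eventually_scale[OF _ low]) (use \<epsilon> in auto)
  have "1 < 1 / (1 - \<epsilon>)" using \<epsilon> by simp
  then have "\<forall>\<^sub>F t in at_top. x t / y t < 1 / (1 - \<epsilon>)" "\<forall>\<^sub>F t in at_top. 1 - \<epsilon> < x t / y t"
    using order_tendstoD[OF lim] \<epsilon> by auto
  then show "\<forall>\<^sub>F t in at_top. dist (f (x t) / f (y t)) 1 < e"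
    using ev_y_pos eventually_F_inv[OF low] eventually_F_inv[OF up]
  proof eventually_elim
    case (elim t)
    have fy: "f (y t) > 0" using elim f_pos by auto
    have "f ((1 - \<epsilon>) * y t) \<le> f (x t)"
      using elim by (intro f_le) (simp add: pos_less_divide_eq)
    with elim(4) have 1: "1 - \<delta> \<le> f (x t) / f (y t)" using fy by (simp add: pos_le_divide_eq)
    have "f (x t) \<le> f (1 / (1 - \<epsilon>) * y t)"
      using elim \<epsilon> by (intro f_le) (simp add: field_simps)
    also have "\<dots> \<le> 1 / (1 - \<delta>) * f (y t)"
    proof -
      have "(1 - \<epsilon>) * (1 / (1 - \<epsilon>) * y t) = y t" using \<epsilon> by simp
      with elim(5) show ?thesis using \<delta>(2) by (simp only: mult_1 times_divide_eq_left pos_le_divide_eq mult.commute[of "f _"] diff_gt_0_iff_gt)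
    qed
    finally have 2: "f (x t) / f (y t) \<le> 1 + e / 2" using fy unfolding \<delta>(3) by (simp add: pos_divide_le_eq)
    show ?case using 1 2 \<delta>(4) \<open>e > 0\<close> by (simp add: dist_real_def abs_less_iff)
  qed
qed

text \<open>Oddness and monotonicity bound \<open>\<bar>f x\<bar>\<close> by
  \<open>f (\<mu> * y)\<close>, and superlinearity bounds that by less than
  \<open>\<mu> * f y\<close>, where \<open>\<mu> \<le> e\<close>.\<close>

lemma f_ratio_tendsto_0:
  assumes lim: "((\<lambda>t. x t / y t) \<longlongrightarrow> 0) at_top"
  shows "((\<lambda>t. f (x t) / f (y t)) \<longlongrightarrow> 0) at_top"
proof (rule tendstoI)
  fix e :: real assume "e > 0"
  define \<mu> where "\<mu> = min e (1 / 2)"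
  have \<mu>: "0 < \<mu>" "\<mu> < 1" "\<mu> \<le> e" using \<open>e > 0\<close> by (auto simp: \<mu>_def)
  obtain m where m: "0 < m" "m < \<mu>" "\<forall>\<^sub>F x in at_right 0. f (\<mu> * x) \<le> m * f x"
    using f_superlinear[OF \<mu>(1,2)] by blast
  have "\<forall>\<^sub>F t in at_top. \<bar>x t / y t\<bar> < \<mu>"
    using order_tendstoD(2)[OF tendsto_rabs_zero[OF lim] \<mu>(1)] .
  then show "\<forall>\<^sub>F t in at_top. dist (f (x t) / f (y t)) 0 < e"
    using ev_y_pos eventually_F_inv[OF m(3)]
  proof eventually_elim
    case (elim t)
    have fy: "f (y t) > 0" using elim f_pos by auto
    have "\<bar>x t\<bar> \<le> \<mu> * y t" using elim(1,2) by (simp add: abs_divide pos_divide_less_eq)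
    then have "\<bar>f (x t)\<bar> \<le> f (\<mu> * y t)" unfolding f_abs by (rule f_le)
    also have "\<dots> \<le> m * f (y t)" by (rule elim)
    also have "\<dots> < e * f (y t)" using fy m \<mu> by (intro mult_strict_right_mono) auto
    finally show ?case using fy by (simp add: dist_real_def pos_divide_less_eq)
  qed
qed

lemma f_ratio_tendsto:
  assumes lim: "((\<lambda>t. x t / y t) \<longlongrightarrow> l) at_top" and l: "l \<in> {1, 0, -1}"
  shows "((\<lambda>t. f (x t) / f (y t)) \<longlongrightarrow> l) at_top"
proof -
  have "((\<lambda>t. f (x t) / f (y t)) \<longlongrightarrow> -1) at_top" if "l = -1"
  proof -
    have "((\<lambda>t. - x t / y t) \<longlongrightarrow> 1) at_top" using tendsto_minus[OF lim] that by simp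
    from tendsto_minus[OF f_ratio_tendsto_1[OF this]] show ?thesis by (simp add: f_odd)
  qed
  then show ?thesis using l f_ratio_tendsto_1 f_ratio_tendsto_0 lim by auto
qed

text \<open>Since \<open>y' = - f y\<close>, a drift \<open>f (x t) \<sim> l f (y t)\<close> integrates to \<open>l y\<close> up to an error
  that is \<open>o(y)\<close>, uniformly on \<open>[t, \<infinity>)\<close>.\<close>

lemma accumulated_drift:
  assumes G: "\<And>t. t > 0 \<Longrightarrow> (G has_real_derivative f (x t)) (at t)"
    and lim: "((\<lambda>t. x t / y t) \<longlongrightarrow> l) at_top" and l: "l \<in> {1, 0, -1}"
  shows "\<exists>g. (G \<longlongrightarrow> g) at_top \<and> ((\<lambda>t. (g - G t) / y t) \<longlongrightarrow> l) at_top"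
proof -
  \<comment> \<open>Adding \<open>l * y\<close> cancels the leading part of the drift: the
    derivative of \<open>H\<close> is \<open>f x - l * f y = o(f y)\<close>.\<close>
  define H where "H t = G t + l * y t" for t
  have H: "(H has_real_derivative f (x t) - l * f (y t)) (at t)" if "t > 0" for t
    unfolding H_def
    by (rule derivative_eq_intros G F_inv_deriv that refl)+ simp
  \<comment> \<open>Both \<open>H + e * y\<close> and \<open>- H + e * y\<close> are eventually
    nonincreasing; as \<open>y\<close> is positive, this controls the oscillation of
    \<open>H\<close> after \<open>t\<close>.\<close>
  have osc: "\<exists>t0>0. \<forall>s t. t0 \<le> t \<longrightarrow> t \<le> s \<longrightarrow> \<bar>H s - H t\<bar> \<le> e * y t" if "e > 0" for e
  proof -
    have "\<forall>\<^sub>F t in at_top. \<bar>f (x t) / f (y t) - l\<bar> < e"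
      using tendstoD[OF f_ratio_tendsto[OF lim l] that] by (simp add: dist_real_def)
    then have small: "\<forall>\<^sub>F t in at_top. \<bar>f (x t) - l * f (y t)\<bar> \<le> e * f (y t)"
      using ev_y_pos
    proof eventually_elim
      case (elim t)
      have fy: "f (y t) > 0" using elim f_pos by auto
      have "f (x t) - l * f (y t) = (f (x t) / f (y t) - l) * f (y t)" using fy by (simp add: field_simps)
      then show ?case using elim(1) fy by (simp add: abs_mult mult_right_mono)
    qed
    have ey: "((\<lambda>t. e * y t) has_real_derivative - (e * f (y t))) (at t)" if "t > 0" for t
      by (rule derivative_eq_intros F_inv_deriv that refl)+ simp
    have "\<forall>\<^sub>F t in at_top. f (x t) - l * f (y t) + - (e * f (y t)) \<le> 0"
      using small by eventually_elim (auto simp: abs_le_iff)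
    then obtain t1 where t1: "t1 > 0" "\<And>s t. t1 \<le> t \<Longrightarrow> t \<le> s \<Longrightarrow> H s + e * y s \<le> H t + e * y t"
      using eventually_decreasing[OF DERIV_add[OF H ey]] by blast
    have "\<forall>\<^sub>F t in at_top. - (f (x t) - l * f (y t)) + - (e * f (y t)) \<le> 0"
      using small by eventually_elim (auto simp: abs_le_iff)
    then obtain t2 where t2: "t2 > 0" "\<And>s t. t2 \<le> t \<Longrightarrow> t \<le> s \<Longrightarrow> - H s + e * y s \<le> - H t + e * y t"
      using eventually_decreasing[OF DERIV_add[OF DERIV_minus[OF H] ey]] by blast
    have "\<bar>H s - H t\<bar> \<le> e * y t" if "max t1 t2 \<le> t" "t \<le> s" for s t
    proof -
      have "e * y s \<ge> 0" using F_inv_props(1)[of s] that t1 \<open>e > 0\<close> by auto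
      then show ?thesis using t1(2)[of t s] t2(2)[of t s] that by auto
    qed
    then show ?thesis using t1(1) by (intro exI[of _ "max t1 t2"]) auto
  qed
  have y0: "(y \<longlongrightarrow> 0) at_top" using F_inv_tendsto_0 by (simp add: filterlim_at)
  \<comment> \<open>Convergence is first obtained along the integers. Letting the later time in the
    oscillation bound run through them then covers all real \<open>t\<close>.\<close>
  have "Cauchy (\<lambda>n. H (real n))"
  proof (rule metric_CauchyI)
    fix e :: real assume "e > 0"
    obtain t0 where t0: "t0 > 0" "\<And>s t. t0 \<le> t \<Longrightarrow> t \<le> s \<Longrightarrow> \<bar>H s - H t\<bar> \<le> 1 * y t"
      using osc[of 1] by auto
    have "\<forall>\<^sub>F n in sequentially. y (real n) < e \<and> real n \<ge> t0"
      by (intro eventually_conj order_tendstoD(2)[OF filterlim_compose[OF y0 filterlim_real_sequentially]]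
          eventually_compose_filterlim[OF eventually_ge_at_top filterlim_real_sequentially] \<open>e > 0\<close>)
    then obtain N where N: "\<And>n. n \<ge> N \<Longrightarrow> y (real n) < e \<and> real n \<ge> t0"
      by (auto simp: eventually_sequentially)
    have close: "dist (H (real n)) (H (real m)) < e" if "N \<le> m" "m \<le> n" for m n
      using t0(2)[of "real m" "real n"] N[of m] that by (auto simp: dist_real_def)
    show "\<exists>M. \<forall>m\<ge>M. \<forall>n\<ge>M. dist (H (real m)) (H (real n)) < e"
      using close dist_commute nle_le by metis
  qed
  then obtain g where g: "(\<lambda>n. H (real n)) \<longlonglongrightarrow> g"
    using real_Cauchy_convergent convergent_def by metis
  have tail: "\<exists>t0>0. \<forall>t\<ge>t0. \<bar>g - H t\<bar> \<le> e * y t" if e: "e > 0" for e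
  proof -
    obtain t0 where t0: "t0 > 0" "\<And>s t. t0 \<le> t \<Longrightarrow> t \<le> s \<Longrightarrow> \<bar>H s - H t\<bar> \<le> e * y t"
      using osc[OF e] by auto
    have "\<bar>g - H t\<bar> \<le> e * y t" if "t \<ge> t0" for t
    proof (rule tendsto_upperbound)
      show "(\<lambda>n. \<bar>H (real n) - H t\<bar>) \<longlonglongrightarrow> \<bar>g - H t\<bar>" by (intro tendsto_intros g)
      show "\<forall>\<^sub>F n in sequentially. \<bar>H (real n) - H t\<bar> \<le> e * y t"
        using eventually_compose_filterlim[OF eventually_ge_at_top[of t] filterlim_real_sequentially]
        by eventually_elim (use t0 that in auto)
    qed auto
    then show ?thesis using t0(1) by auto
  qed
  have lim0: "((\<lambda>t. (g - H t) / y t) \<longlongrightarrow> 0) at_top"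
  proof (rule tendstoI)
    fix e :: real assume "e > 0"
    then obtain t0 where t0: "t0 > 0" "\<And>t. t \<ge> t0 \<Longrightarrow> \<bar>g - H t\<bar> \<le> e / 2 * y t"
      using tail[of "e / 2"] by auto
    show "\<forall>\<^sub>F t in at_top. dist ((g - H t) / y t) 0 < e"
      using ev_y_pos eventually_ge_at_top[of t0]
    proof eventually_elim
      case (elim t)
      have "\<bar>g - H t\<bar> \<le> e / 2 * y t" using t0 elim by auto
      also have "\<dots> < e * y t" using elim \<open>e > 0\<close> by simp
      finally show ?case using elim by (simp add: dist_real_def pos_divide_less_eq)
    qed
  qed
  then have "((\<lambda>t. (g - H t) / y t + l) \<longlongrightarrow> 0 + l) at_top"
    by (intro tendsto_add tendsto_const)
  moreover have "\<forall>\<^sub>F t in at_top. (g - H t) / y t + l = (g - G t) / y t"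
    using ev_y_pos by eventually_elim (simp add: H_def field_simps)
  ultimately have *: "((\<lambda>t. (g - G t) / y t) \<longlongrightarrow> l) at_top"
    using tendsto_cong by fastforce
  have "((\<lambda>t. g - (g - G t) / y t * y t) \<longlongrightarrow> g - l * 0) at_top"
    by (intro tendsto_intros * y0)
  moreover have "\<forall>\<^sub>F t in at_top. g - (g - G t) / y t * y t = G t"
    using ev_y_pos by eventually_elim auto
  ultimately have "(G \<longlongrightarrow> g) at_top" using tendsto_cong by fastforce
  with * show ?thesis by blast
qed

section \<open>The two implications along a single path\<close>

text \<open>Adding \<open>c - i\<close> cancels the noise: \<open>Z\<close> is a constant minus the
  integral of a continuous function, hence differentiable. The smallness assumption itself forces
  \<open>i\<close> to tend to \<open>c\<close>, since \<open>y\<close> tends to 0.\<close>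

lemma path_limit_of_tail:
  fixes x i :: "real \<Rightarrow> real"
  assumes cont: "continuous_on {0..} x"
    and eq: "\<And>t. t \<ge> 0 \<Longrightarrow> x t = \<xi> - (LBINT s:{0..t}. f (x s)) + i t"
    and lim: "((\<lambda>t. (c - i t) / y t) \<longlongrightarrow> 0) at_top"
  shows "\<exists>l\<in>{1, 0, -1}. ((\<lambda>t. x t / y t) \<longlongrightarrow> l) at_top"
proof -
  define Z where "Z t = \<xi> + c - (LBINT s:{0..t}. f (x s))" for t
  have xZ: "x t = Z t - (c - i t)" if "t \<ge> 0" for t using eq[OF that] by (simp add: Z_def)
  have fx: "continuous_on {0..} (\<lambda>t. f (x t))"
    by (rule continuous_on_compose2[OF f_cont[of UNIV] cont]) auto
  have "(Z has_real_derivative - f (Z t - (c - i t))) (at t)" if "t > 0" for t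
  proof -
    have "(Z has_real_derivative - f (x t)) (at t)"
      unfolding Z_def by (rule derivative_eq_intros set_integral_deriv fx that refl)+ simp
    then show ?thesis using xZ that by simp
  qed
  then have "perturbed Z (\<lambda>t. c - i t)" using lim by (simp add: perturbed_def)
  then obtain l where l: "l \<in> {1, 0, -1}" "((\<lambda>t. Z t / y t) \<longlongrightarrow> l) at_top"
    using ratio_limit by blast
  have "((\<lambda>t. Z t / y t - (c - i t) / y t) \<longlongrightarrow> l - 0) at_top"
    by (intro tendsto_diff l lim)
  moreover have "\<forall>\<^sub>F t in at_top. Z t / y t - (c - i t) / y t = x t / y t"
    using eventually_ge_at_top[of 0] by eventually_elim (simp add: xZ diff_divide_distrib)
  ultimately show ?thesis using l(1) tendsto_cong by fastforce
qed

text \<open>\<open>g - \<xi> - i = (g - G) - x\<close>, and both terms on the right are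
  \<open>l * y + o(y)\<close>. Convergence of \<open>i\<close> follows because \<open>y\<close>
  tends to 0.\<close>

lemma path_tail_of_limit:
  fixes x i :: "real \<Rightarrow> real"
  assumes cont: "continuous_on {0..} x"
    and eq: "\<And>t. t \<ge> 0 \<Longrightarrow> x t = \<xi> - (LBINT s:{0..t}. f (x s)) + i t"
    and l: "l \<in> {1, 0, -1}" and lim: "((\<lambda>t. x t / y t) \<longlongrightarrow> l) at_top"
  shows "\<exists>c. (i \<longlongrightarrow> c) at_top \<and> ((\<lambda>t. (c - i t) / y t) \<longlongrightarrow> 0) at_top"
proof -
  define G where "G t = (LBINT s:{0..t}. f (x s))" for t
  have fx: "continuous_on {0..} (\<lambda>t. f (x t))"
    by (rule continuous_on_compose2[OF f_cont[of UNIV] cont]) auto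
  have "(G has_real_derivative f (x t)) (at t)" if "t > 0" for t
    unfolding G_def by (rule set_integral_deriv[OF fx that])
  from accumulated_drift[OF this lim l] obtain g
    where g: "(G \<longlongrightarrow> g) at_top" "((\<lambda>t. (g - G t) / y t) \<longlongrightarrow> l) at_top" by blast
  have y0: "(y \<longlongrightarrow> 0) at_top" using F_inv_tendsto_0 by (simp add: filterlim_at)
  have "((\<lambda>t. (g - G t) / y t - x t / y t) \<longlongrightarrow> l - l) at_top"
    by (intro tendsto_diff g lim)
  moreover have "\<forall>\<^sub>F t in at_top. (g - G t) / y t - x t / y t = (g - \<xi> - i t) / y t"
    using eventually_ge_at_top[of 0]
    by eventually_elim (simp add: eq G_def diff_divide_distrib add_divide_distrib)
  ultimately have *: "((\<lambda>t. (g - \<xi> - i t) / y t) \<longlongrightarrow> 0) at_top"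
    using tendsto_cong by fastforce
  have "((\<lambda>t. g - \<xi> - (g - \<xi> - i t) / y t * y t) \<longlongrightarrow> g - \<xi> - 0 * 0) at_top"
    by (intro tendsto_intros * y0)
  moreover have "\<forall>\<^sub>F t in at_top. g - \<xi> - (g - \<xi> - i t) / y t * y t = i t"
    using ev_y_pos by eventually_elim auto
  ultimately have "(i \<longlongrightarrow> g - \<xi>) at_top" using tendsto_cong by fastforce
  with * show ?thesis by blast
qed

end

section \<open>Boundedness of the variance\<close>

lemma partition_mono:
  fixes p :: "nat \<Rightarrow> real"
  assumes "\<And>i. i < n \<Longrightarrow> p i \<le> p (Suc i)" "i \<le> j" "j \<le> n"
  shows "p i \<le> p j"
  using assms(2,3)
proof (induction j rule: dec_induct)
  case (step j)
  then show ?case using assms(1)[of j] by simp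
qed simp

text \<open>The half-open cells of an ordered partition are disjoint, so the cross terms
  vanish.\<close>

lemma step_fun_square:
  assumes "\<And>i. i < n \<Longrightarrow> p i \<le> p (Suc i)"
  shows "(step_fun n p c s)\<^sup>2 = (\<Sum>i<n. (c i)\<^sup>2 * indicator {p i<..p (Suc i)} s)"
  using assms
proof (induction n)
  case (Suc n)
  have IH: "(step_fun n p c s)\<^sup>2 = (\<Sum>i<n. (c i)\<^sup>2 * indicator {p i<..p (Suc i)} s)"
    by (rule Suc.IH) (use Suc.prems in auto)
  have "step_fun n p c s = 0" if "s \<in> {p n<..p (Suc n)}"
    unfolding step_fun_def
  proof (intro sum.neutral ballI)
    fix i assume i: "i \<in> {..<n}"
    have "p (Suc i) \<le> p n" by (rule partition_mono[of n p]) (use Suc.prems i in auto)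
    then show "c i * indicator {p i<..p (Suc i)} s = 0" using that by simp
  qed
  moreover have "step_fun (Suc n) p c s = step_fun n p c s + c n * indicator {p n<..p (Suc n)} s"
    by (simp add: step_fun_def)
  ultimately have "(step_fun (Suc n) p c s)\<^sup>2
      = (step_fun n p c s)\<^sup>2 + (c n)\<^sup>2 * indicator {p n<..p (Suc n)} s"
    by (cases "s \<in> {p n<..p (Suc n)}") auto
  with IH show ?case by simp
qed (simp add: step_fun_def)

lemma step_fun_measurable [measurable]: "step_fun n p c \<in> borel_measurable borel"
  unfolding step_fun_def by measurable

text \<open>The right-hand side is also the variance of \<open>step_integral\<close>: this is the
  isometry through which \<open>\<sigma>\<close> controls the variance.\<close>

lemma nn_integral_step_fun_square:
  assumes "\<And>i. i < n \<Longrightarrow> p i \<le> p (Suc i)"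
  shows "(\<integral>\<^sup>+ s. ennreal ((step_fun n p c s)\<^sup>2) \<partial>lborel)
    = ennreal (\<Sum>i<n. (c i)\<^sup>2 * (p (Suc i) - p i))"
proof -
  have "ennreal ((step_fun n p c s)\<^sup>2)
      = (\<Sum>i<n. ennreal ((c i)\<^sup>2) * indicator {p i<..p (Suc i)} s)" for s
  proof -
    have "(\<Sum>i<n. ennreal ((c i)\<^sup>2) * indicator {p i<..p (Suc i)} s)
        = (\<Sum>i<n. ennreal ((c i)\<^sup>2 * indicator {p i<..p (Suc i)} s))"
      by (intro sum.cong) (auto split: split_indicator)
    also have "\<dots> = ennreal (\<Sum>i<n. (c i)\<^sup>2 * indicator {p i<..p (Suc i)} s)"
      by (rule sum_ennreal) simp
    finally show ?thesis using step_fun_square[of n p, OF assms] by simp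
  qed
  then have "(\<integral>\<^sup>+ s. ennreal ((step_fun n p c s)\<^sup>2) \<partial>lborel)
      = (\<integral>\<^sup>+ s. (\<Sum>i<n. ennreal ((c i)\<^sup>2) * indicator {p i<..p (Suc i)} s) \<partial>lborel)"
    by (intro nn_integral_cong) blast
  also have "\<dots> = (\<Sum>i<n. \<integral>\<^sup>+ s. ennreal ((c i)\<^sup>2) * indicator {p i<..p (Suc i)} s \<partial>lborel)"
    by (rule nn_integral_sum) measurable
  also have "\<dots> = (\<Sum>i<n. ennreal ((c i)\<^sup>2 * (p (Suc i) - p i)))"
    using assms by (intro sum.cong) (auto simp: nn_integral_cmult_indicator ennreal_mult)
  also have "\<dots> = ennreal (\<Sum>i<n. (c i)\<^sup>2 * (p (Suc i) - p i))"
    using assms by (intro sum_ennreal) auto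
  finally show ?thesis .
qed

section \<open>Small-ball estimates for Gaussian variables and Ito integrals\<close>

lemma normal_density_le:
  assumes "\<sigma> > 0"
  shows "normal_density \<mu> \<sigma> x \<le> 1 / \<sigma>"
proof -
  have "1 \<le> 2 * pi" using pi_ge_two by simp
  then have "1 \<le> sqrt (2 * pi)" by simp
  then have "\<sigma> \<le> sqrt (2 * pi) * \<sigma>" using assms by simp
  then have "1 / sqrt (2 * pi * \<sigma>\<^sup>2) \<le> 1 / \<sigma>"
    using assms by (intro divide_left_mono) (auto simp: real_sqrt_mult)
  moreover have "exp (- (x - \<mu>)\<^sup>2 / (2 * \<sigma>\<^sup>2)) \<le> 1" using assms by simp
  ultimately show ?thesis
    using mult_mono[of "1 / sqrt (2 * pi * \<sigma>\<^sup>2)" "1 / \<sigma>" "exp (- (x - \<mu>)\<^sup>2 / (2 * \<sigma>\<^sup>2))" 1]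
      assms by (simp add: normal_density_def)
qed

text \<open>The density is at most \<open>1 / \<sigma>\<close> and the interval has length
  \<open>2 * K\<close>: a large variance leaves little mass on a fixed interval.\<close>

lemma (in prob_space) normal_small_ball:
  assumes X: "distributed M lborel X (normal_density \<mu> \<sigma>)" and "\<sigma> > 0" "K \<ge> 0"
  shows "prob {\<omega> \<in> space M. \<bar>X \<omega>\<bar> \<le> K} \<le> 2 * K / \<sigma>"
proof -
  have "{\<omega> \<in> space M. \<bar>X \<omega>\<bar> \<le> K} = X -` {-K..K} \<inter> space M" by auto
  then have "emeasure M {\<omega> \<in> space M. \<bar>X \<omega>\<bar> \<le> K}
      = (\<integral>\<^sup>+ x. ennreal (normal_density \<mu> \<sigma> x) * indicator {-K..K} x \<partial>lborel)"
    using distributed_emeasure[OF X] by simp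
  also have "\<dots> \<le> (\<integral>\<^sup>+ x. ennreal (1 / \<sigma>) * indicator {-K..K} x \<partial>lborel)"
    by (intro nn_integral_mono mult_right_mono ennreal_leI normal_density_le) (use assms in auto)
  also have "\<dots> = ennreal (2 * K / \<sigma>)"
    using assms by (simp add: nn_integral_cmult_indicator ennreal_mult[symmetric] field_simps)
  finally show ?thesis using assms by (simp add: emeasure_eq_measure ennreal_le_iff)
qed

text \<open>By independence of the increments the step integral is a centred Gaussian with variance
  \<open>V\<close>.\<close>

lemma step_integral_small_ball:
  assumes bm: "brownian_motion M B"
    and p0: "0 \<le> p 0" and mono: "\<And>i. i < n \<Longrightarrow> p i \<le> p (Suc i)"
    and V: "V = (\<Sum>i<n. (c i)\<^sup>2 * (p (Suc i) - p i))" "V > 0" and "K \<ge> 0"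
  shows "measure M {\<omega> \<in> space M. \<bar>step_integral B n p c \<omega>\<bar> \<le> K} \<le> 2 * K / sqrt V"
proof -
  interpret prob_space M using bm by (simp add: brownian_motion_def)
  \<comment> \<open>Terms with zero coefficient or empty cell are dropped, because independent
    normals are summed with positive standard deviations. Positivity of \<open>V\<close> keeps
    \<open>J\<close> nonempty.\<close>
  define J where "J = {i\<in>{..<n}. c i \<noteq> 0 \<and> p i < p (Suc i)}"
  let ?D = "\<lambda>i \<omega>. B (p (Suc i)) \<omega> - B (p i) \<omega>"
  have J: "finite J" "J \<subseteq> {..<n}" by (auto simp: J_def)
  have out: "c i = 0 \<or> p (Suc i) = p i" if "i \<in> {..<n} - J" for i
    using that mono[of i] by (auto simp: J_def)
  have S: "step_integral B n p c \<omega> = (\<Sum>i\<in>J. 0 + c i * ?D i \<omega>)" for \<omega>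
    unfolding step_integral_def by (rule sum.mono_neutral_cong_right) (use J out in force)+
  let ?s = "\<lambda>i. \<bar>c i\<bar> * sqrt (p (Suc i) - p i)"
  have VJ: "V = (\<Sum>i\<in>J. (?s i)\<^sup>2)"
    unfolding V(1) by (rule sum.mono_neutral_cong_right)
      (use J out in \<open>force simp: power_mult_distrib J_def\<close>)+
  have ne: "J \<noteq> {}" using VJ V(2) by auto
  have "indep_vars (\<lambda>_. borel) ?D {..<n}"
    using bm p0 mono unfolding brownian_motion_def by blast
  then have ind: "indep_vars (\<lambda>_. borel) (\<lambda>i \<omega>. 0 + c i * ?D i \<omega>) J"
    by (intro indep_vars_compose2[where M' = "\<lambda>_. borel" and Y = "\<lambda>i x. 0 + c i * x"]
        indep_vars_subset[OF _ J(2)]) auto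
  have "distributed M lborel (\<lambda>\<omega>. \<Sum>i\<in>J. 0 + c i * ?D i \<omega>)
      (normal_density (\<Sum>i\<in>J. 0 + c i * 0) (sqrt (\<Sum>i\<in>J. (?s i)\<^sup>2)))"
  proof (rule sum_indep_normal[OF J(1) ne ind])
    fix i assume i: "i \<in> J"
    then have "0 \<le> p i" using partition_mono[of n p 0 i, OF mono] p0 by (auto simp: J_def)
    then have "distributed M lborel (?D i) (normal_density 0 (sqrt (p (Suc i) - p i)))"
      using bm i unfolding brownian_motion_def J_def by blast
    then show "distributed M lborel (\<lambda>\<omega>. 0 + c i * ?D i \<omega>) (normal_density (0 + c i * 0) (?s i))"
      using i by (intro normal_density_affine) (auto simp: J_def)
    show "0 < ?s i" using i by (auto simp: J_def)
  qed
  then have "distributed M lborel (step_integral B n p c) (normal_density 0 (sqrt V))"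
    unfolding S[abs_def] VJ by simp
  then show ?thesis using V(2) \<open>K \<ge> 0\<close> by (intro normal_small_ball) auto
qed

lemma step_integral_measurable:
  assumes bm: "brownian_motion M B" and p0: "0 \<le> p 0" and mono: "\<And>i. i < n \<Longrightarrow> p i \<le> p (Suc i)"
  shows "step_integral B n p c \<in> borel_measurable M"
proof -
  have "B (p i) \<in> borel_measurable M" if "i \<le> n" for i
  proof -
    have "0 \<le> p i" using partition_mono[of n p 0 i, OF mono] p0 that by simp
    then show ?thesis using bm unfolding brownian_motion_def by blast
  qed
  then show ?thesis unfolding step_integral_def[abs_def]
    by (intro borel_measurable_sum borel_measurable_times borel_measurable_diff) auto
qed

text \<open>A step integral close to \<open>Y\<close> in mean square has variance at least
  \<open>v / 4\<close>. If \<open>Y\<close> is at most \<open>K\<close> in size, either the step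
  integral is at most \<open>K + 1\<close> in size or it differs from \<open>Y\<close> by at least
  1; the Gaussian estimate and Markov's inequality bound these two events.\<close>

lemma ito_integral_small_ball:
  assumes bm: "brownian_motion M B" and sigma: "continuous_on {0..} \<sigma>"
    and ito: "has_ito_integral M B \<sigma> t Y"
    and v: "v > 0" "ennreal v \<le> (\<integral>\<^sup>+ s\<in>{0..t}. ennreal ((\<sigma> s)\<^sup>2) \<partial>lborel)"
    and "K \<ge> 0" "\<eta> > 0"
  shows "measure M {\<omega> \<in> space M. \<bar>Y \<omega>\<bar> \<le> K} \<le> 2 * (K + 1) / sqrt (v / 4) + \<eta>"
proof -
  interpret prob_space M using bm by (simp add: brownian_motion_def)
  from ito obtain n p c where Y[measurable]: "Y \<in> borel_measurable M"
    and part: "\<And>k. p k 0 = 0" "\<And>k. p k (n k) = t" "\<And>k i. i < n k \<Longrightarrow> p k i \<le> p k (Suc i)"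
    and L1: "(\<lambda>k. \<integral>\<^sup>+ s\<in>{0..t}. ennreal ((\<sigma> s - step_fun (n k) (p k) (c k) s)\<^sup>2) \<partial>lborel) \<longlonglongrightarrow> 0"
    and L2: "(\<lambda>k. \<integral>\<^sup>+ \<omega>. ennreal ((Y \<omega> - step_integral B (n k) (p k) (c k) \<omega>)\<^sup>2) \<partial>M) \<longlonglongrightarrow> 0"
    unfolding has_ito_integral_def by blast
  \<comment> \<open>The tolerance \<open>v / 4\<close> leads to
    \<open>v \<le> 2 * V + v / 2\<close>, hence \<open>v / 4 \<le> V\<close>; the tolerance
    \<open>\<eta>\<close> is the Markov bound.\<close>
  have "\<forall>\<^sub>F k in sequentially.
      (\<integral>\<^sup>+ s\<in>{0..t}. ennreal ((\<sigma> s - step_fun (n k) (p k) (c k) s)\<^sup>2) \<partial>lborel) < ennreal (v / 4) \<and>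
      (\<integral>\<^sup>+ \<omega>. ennreal ((Y \<omega> - step_integral B (n k) (p k) (c k) \<omega>)\<^sup>2) \<partial>M) < ennreal \<eta>"
    by (intro eventually_conj order_tendstoD(2)[OF L1] order_tendstoD(2)[OF L2]) (use v \<open>\<eta> > 0\<close> in auto)
  then obtain k where
    k1: "(\<integral>\<^sup>+ s\<in>{0..t}. ennreal ((\<sigma> s - step_fun (n k) (p k) (c k) s)\<^sup>2) \<partial>lborel) < ennreal (v / 4)" and
    k2: "(\<integral>\<^sup>+ \<omega>. ennreal ((Y \<omega> - step_integral B (n k) (p k) (c k) \<omega>)\<^sup>2) \<partial>M) < ennreal \<eta>"
    using eventually_happens'[OF sequentially_bot] by blast
  let ?g = "step_fun (n k) (p k) (c k)" and ?S = "step_integral B (n k) (p k) (c k)"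
  define V where "V = (\<Sum>i<n k. (c k i)\<^sup>2 * (p k (Suc i) - p k i))"
  have S[measurable]: "?S \<in> borel_measurable M"
    by (rule step_integral_measurable[OF bm]) (use part in auto)
  \<comment> \<open>Continuity is given on the half-line; extension by 0 yields Borel measurability
    on the whole line.\<close>
  define \<sigma>' where "\<sigma>' s = indicator {0..} s *\<^sub>R \<sigma> s" for s
  have [measurable]: "\<sigma>' \<in> borel_measurable borel"
    unfolding \<sigma>'_def by (rule borel_measurable_continuous_on_indicator[OF _ sigma]) auto
  have sq: "a\<^sup>2 \<le> 2 * b\<^sup>2 + 2 * (a - b)\<^sup>2" for a b :: real
    using zero_le_power2[of "a - 2 * b"] by (simp add: power2_eq_square algebra_simps)
  have "ennreal v \<le> (\<integral>\<^sup>+ s\<in>{0..t}. ennreal ((\<sigma> s)\<^sup>2) \<partial>lborel)" by (rule v)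
  also have "\<dots> \<le> (\<integral>\<^sup>+ s. 2 * ennreal ((?g s)\<^sup>2)
      + 2 * (ennreal ((\<sigma>' s - ?g s)\<^sup>2) * indicator {0..t} s) \<partial>lborel)"
  proof (rule nn_integral_mono)
    fix s
    have "ennreal ((\<sigma> s)\<^sup>2) \<le> ennreal (2 * (?g s)\<^sup>2 + 2 * (\<sigma> s - ?g s)\<^sup>2)"
      by (intro ennreal_leI sq)
    also have "\<dots> = 2 * ennreal ((?g s)\<^sup>2) + 2 * ennreal ((\<sigma> s - ?g s)\<^sup>2)"
      by (simp add: ennreal_plus ennreal_mult)
    finally show "ennreal ((\<sigma> s)\<^sup>2) * indicator {0..t} s
      \<le> 2 * ennreal ((?g s)\<^sup>2) + 2 * (ennreal ((\<sigma>' s - ?g s)\<^sup>2) * indicator {0..t} s)"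
      by (auto simp: \<sigma>'_def split: split_indicator)
  qed
  also have "\<dots> = 2 * (\<integral>\<^sup>+ s. ennreal ((?g s)\<^sup>2) \<partial>lborel)
      + 2 * (\<integral>\<^sup>+ s\<in>{0..t}. ennreal ((\<sigma>' s - ?g s)\<^sup>2) \<partial>lborel)"
    by (simp add: nn_integral_add nn_integral_cmult)
  also have "(\<integral>\<^sup>+ s\<in>{0..t}. ennreal ((\<sigma>' s - ?g s)\<^sup>2) \<partial>lborel)
      = (\<integral>\<^sup>+ s\<in>{0..t}. ennreal ((\<sigma> s - ?g s)\<^sup>2) \<partial>lborel)"
    by (rule nn_integral_cong) (auto simp: \<sigma>'_def split: split_indicator)
  also have "(\<integral>\<^sup>+ s. ennreal ((?g s)\<^sup>2) \<partial>lborel) = ennreal V"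
    unfolding V_def by (rule nn_integral_step_fun_square) (use part in auto)
  also have "2 * ennreal V + 2 * (\<integral>\<^sup>+ s\<in>{0..t}. ennreal ((\<sigma> s - ?g s)\<^sup>2) \<partial>lborel)
      \<le> 2 * ennreal V + 2 * ennreal (v / 4)"
    using k1 by (intro add_left_mono mult_left_mono) auto
  also have "\<dots> = ennreal (2 * V + v / 2)"
  proof -
    have "V \<ge> 0" unfolding V_def using part by (intro sum_nonneg) auto
    then have "ennreal (2 * V + v / 2) = ennreal (2 * V) + ennreal (2 * (v / 4))"
      using v(1) by (subst ennreal_plus[symmetric]) auto
    then show ?thesis
      using v(1) \<open>V \<ge> 0\<close> unfolding ennreal_mult'[of 2, OF zero_le_numeral] by simp
  qed
  finally have "v \<le> 2 * V + v / 2" using v(1)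
    by (metis ennreal_le_iff2 not_le order.strict_implies_order order_trans)
  then have V: "v / 4 \<le> V" "V > 0" using v(1) by auto
  have b1: "prob {\<omega> \<in> space M. \<bar>?S \<omega>\<bar> \<le> K + 1} \<le> 2 * (K + 1) / sqrt V"
    by (rule step_integral_small_ball[OF bm _ _ V_def]) (use part V \<open>K \<ge> 0\<close> in auto)
  also have "\<dots> \<le> 2 * (K + 1) / sqrt (v / 4)"
    using V v(1) \<open>K \<ge> 0\<close> by (intro divide_left_mono) auto
  finally have b1: "prob {\<omega> \<in> space M. \<bar>?S \<omega>\<bar> \<le> K + 1} \<le> 2 * (K + 1) / sqrt (v / 4)" .
  have "emeasure M {\<omega> \<in> space M. 1 \<le> 1 * ennreal ((Y \<omega> - ?S \<omega>)\<^sup>2)}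
      \<le> 1 * (\<integral>\<^sup>+ \<omega>. ennreal ((Y \<omega> - ?S \<omega>)\<^sup>2) * indicator (space M) \<omega> \<partial>M)"
    by (rule nn_integral_Markov_inequality) auto
  also have "\<dots> = (\<integral>\<^sup>+ \<omega>. ennreal ((Y \<omega> - ?S \<omega>)\<^sup>2) \<partial>M)"
    by (auto intro!: nn_integral_cong)
  also have "\<dots> \<le> ennreal \<eta>" using k2 by simp
  also have "{\<omega> \<in> space M. 1 \<le> 1 * ennreal ((Y \<omega> - ?S \<omega>)\<^sup>2)} = {\<omega> \<in> space M. 1 \<le> (Y \<omega> - ?S \<omega>)\<^sup>2}"
    by (auto simp: ennreal_ge_1)
  finally have b2: "prob {\<omega> \<in> space M. 1 \<le> (Y \<omega> - ?S \<omega>)\<^sup>2} \<le> \<eta>"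
    using \<open>\<eta> > 0\<close> by (simp add: emeasure_eq_measure ennreal_le_iff)
  have "prob {\<omega> \<in> space M. \<bar>Y \<omega>\<bar> \<le> K}
      \<le> prob ({\<omega> \<in> space M. \<bar>?S \<omega>\<bar> \<le> K + 1} \<union> {\<omega> \<in> space M. 1 \<le> (Y \<omega> - ?S \<omega>)\<^sup>2})"
  proof (rule finite_measure_mono)
    show "{\<omega> \<in> space M. \<bar>Y \<omega>\<bar> \<le> K}
      \<subseteq> {\<omega> \<in> space M. \<bar>?S \<omega>\<bar> \<le> K + 1} \<union> {\<omega> \<in> space M. 1 \<le> (Y \<omega> - ?S \<omega>)\<^sup>2}"
    proof
      fix \<omega> assume *: "\<omega> \<in> {\<omega> \<in> space M. \<bar>Y \<omega>\<bar> \<le> K}"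
      show "\<omega> \<in> {\<omega> \<in> space M. \<bar>?S \<omega>\<bar> \<le> K + 1} \<union> {\<omega> \<in> space M. 1 \<le> (Y \<omega> - ?S \<omega>)\<^sup>2}"
      proof (cases "1 \<le> \<bar>Y \<omega> - ?S \<omega>\<bar>")
        case True
        then have "1 \<le> (Y \<omega> - ?S \<omega>)\<^sup>2" by (metis one_le_power power2_abs)
        then show ?thesis using * by simp
      next
        case False
        then show ?thesis using * by auto
      qed
    qed
  qed measurable
  also have "\<dots> \<le> prob {\<omega> \<in> space M. \<bar>?S \<omega>\<bar> \<le> K + 1} + prob {\<omega> \<in> space M. 1 \<le> (Y \<omega> - ?S \<omega>)\<^sup>2}"
    by (rule measure_Un_le) measurable
  finally show ?thesis using b1 b2 by simp
qed

text \<open>Almost sure boundedness is tightness, which for Gaussian variables forces bounded variances.\<close>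

lemma bounded_ito_integral_imp_square_integrable:
  assumes bm: "brownian_motion M B" and sigma: "continuous_on {0..} \<sigma>"
    and ito: "ito_integral_process M B \<sigma> I"
    and bounded: "AE \<omega> in M. \<exists>C. \<forall>n. \<bar>I (real n) \<omega>\<bar> \<le> C"
  shows "set_integrable lborel {0<..} (\<lambda>s. (\<sigma> s)\<^sup>2)"
proof -
  interpret prob_space M using bm by (simp add: brownian_motion_def)
  have I: "has_ito_integral M B \<sigma> t (I t)" if "t \<ge> 0" for t
    using ito that by (auto simp: ito_integral_process_def)
  have [measurable]: "I (real n) \<in> borel_measurable M" for n
    using I[of "real n"] by (simp add: has_ito_integral_def)
  \<comment> \<open>These increasing events exhaust the space up to a null set, so one of them has
    probability above 1/2.\<close>
  define A where "A K = {\<omega> \<in> space M. \<forall>n. \<bar>I (real n) \<omega>\<bar> \<le> real K}" for K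
  have [measurable]: "A K \<in> events" for K unfolding A_def by measurable
  have "incseq A"
  proof (rule incseq_SucI, rule subsetI)
    fix K \<omega> assume *: "\<omega> \<in> A K"
    have "\<bar>I (real n) \<omega>\<bar> \<le> real (Suc K)" for n
    proof -
      have "\<bar>I (real n) \<omega>\<bar> \<le> real K" using * by (simp add: A_def)
      then show ?thesis by simp
    qed
    with * show "\<omega> \<in> A (Suc K)" by (simp add: A_def)
  qed
  then have "(\<lambda>K. prob (A K)) \<longlonglongrightarrow> prob (\<Union>K. A K)"
    by (intro finite_Lim_measure_incseq) auto
  moreover have "prob (\<Union>K. A K) = 1"
  proof (subst prob_eq_1)
    show "AE \<omega> in M. \<omega> \<in> (\<Union>K. A K)"
      using bounded AE_space
    proof eventually_elim
      case (elim \<omega>)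
      then obtain C where C: "\<And>n. \<bar>I (real n) \<omega>\<bar> \<le> C" by blast
      obtain K where "C \<le> real K" using real_arch_simple by blast
      then have "\<bar>I (real n) \<omega>\<bar> \<le> real K" for n using C[of n] by linarith
      then have "\<omega> \<in> A K" using elim(2) by (simp add: A_def)
      then show ?case by blast
    qed
  qed auto
  ultimately have "(\<lambda>K. prob (A K)) \<longlonglongrightarrow> 1" by simp
  then have "\<forall>\<^sub>F K in sequentially. prob (A K) > 1 / 2" by (rule order_tendstoD) simp
  then obtain K where K: "prob (A K) > 1 / 2"
    using eventually_happens'[OF sequentially_bot] by blast
  \<comment> \<open>With this \<open>v\<close> the Gaussian term equals 1/4; taking
    \<open>\<eta> = 1 / 4\<close> as well, the total 1/2 contradicts the choice of
    \<open>K\<close>.\<close>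
  define v where "v = (16 * (real K + 1))\<^sup>2"
  have v: "v > 0" "sqrt (v / 4) = 8 * (real K + 1)" by (auto simp: v_def real_sqrt_divide)
  have bd: "(\<integral>\<^sup>+ s\<in>{0..real n}. ennreal ((\<sigma> s)\<^sup>2) \<partial>lborel) \<le> ennreal v" for n
  proof (rule ccontr)
    assume "\<not> ?thesis"
    then have *: "ennreal v \<le> (\<integral>\<^sup>+ s\<in>{0..real n}. ennreal ((\<sigma> s)\<^sup>2) \<partial>lborel)" by simp
    have "prob (A K) \<le> prob {\<omega> \<in> space M. \<bar>I (real n) \<omega>\<bar> \<le> real K}"
      unfolding A_def by (rule finite_measure_mono) auto
    also have "\<dots> \<le> 2 * (real K + 1) / sqrt (v / 4) + 1 / 4"
      by (rule ito_integral_small_ball[OF bm sigma I v(1) *]) auto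
    also have "\<dots> = 1 / 2" unfolding v(2) by (simp add: field_simps)
    finally show False using K by simp
  qed
  let ?h = "\<lambda>n s. ennreal ((\<sigma> s)\<^sup>2) * indicator {0..real n} s"
  define \<sigma>' where "\<sigma>' s = indicator {0..} s *\<^sub>R \<sigma> s" for s
  have [measurable]: "\<sigma>' \<in> borel_measurable borel"
    unfolding \<sigma>'_def by (rule borel_measurable_continuous_on_indicator[OF _ sigma]) auto
  have h: "?h n = (\<lambda>s. ennreal ((\<sigma>' s)\<^sup>2) * indicator {0..real n} s)" for n
    by (rule ext) (auto simp: \<sigma>'_def split: split_indicator)
  \<comment> \<open>Monotone convergence carries the bound \<open>v\<close>, uniform in
    \<open>n\<close>, to the half-line.\<close>
  have "incseq ?h"
    by (auto simp: incseq_def le_fun_def split: split_indicator)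
  have "(\<integral>\<^sup>+ s. (SUP n. ?h n s) \<partial>lborel) = (SUP n. integral\<^sup>N lborel (?h n))"
    by (rule nn_integral_monotone_convergence_SUP[OF \<open>incseq ?h\<close>]) (simp add: h)
  also have "\<dots> \<le> ennreal v" using bd by (auto intro: SUP_least)
  finally have sup: "(\<integral>\<^sup>+ s. (SUP n. ?h n s) \<partial>lborel) \<le> ennreal v" .
  have "(\<integral>\<^sup>+ s. ennreal (norm (indicator {0<..} s *\<^sub>R (\<sigma> s)\<^sup>2)) \<partial>lborel)
      \<le> (\<integral>\<^sup>+ s. (SUP n. ?h n s) \<partial>lborel)"
  proof (rule nn_integral_mono)
    fix s :: real
    obtain n where "s \<le> real n" using real_arch_simple by blast
    then have "ennreal (norm (indicator {0<..} s *\<^sub>R (\<sigma> s)\<^sup>2)) \<le> ?h n s"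
      by (auto split: split_indicator)
    also have "\<dots> \<le> (SUP n. ?h n s)" by (rule SUP_upper) simp
    finally show "ennreal (norm (indicator {0<..} s *\<^sub>R (\<sigma> s)\<^sup>2)) \<le> (SUP n. ?h n s)" .
  qed
  with sup have fin: "(\<integral>\<^sup>+ s. ennreal (norm (indicator {0<..} s *\<^sub>R (\<sigma> s)\<^sup>2)) \<partial>lborel) < \<infinity>"
    by (simp add: le_less_trans[OF order_trans])
  have "(\<lambda>s. indicator {0<..} s *\<^sub>R (\<sigma> s)\<^sup>2) = (\<lambda>s. indicator {0<..} s *\<^sub>R (\<sigma>' s)\<^sup>2)"
    by (auto simp: \<sigma>'_def split: split_indicator)
  then have "(\<lambda>s. indicator {0<..} s *\<^sub>R (\<sigma> s)\<^sup>2) \<in> borel_measurable lborel" by simp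
  with fin show ?thesis unfolding set_integrable_def integrable_iff_bounded by simp
qed

section \<open>From single paths to almost sure statements\<close>

text \<open>The augmenting null sets belong to \<open>sets M\<close>, so all generators of the
  filtration do. This supplies the measurability of \<open>\<Lambda>\<close>.\<close>

lemma adapted_measurable:
  assumes bm: "brownian_motion M B" and ad: "adapted_process M B X" and "t \<ge> 0"
  shows "X t \<in> borel_measurable M"
proof -
  let ?G = "{B s -` A \<inter> space M |s A. s \<in> {0..t} \<and> A \<in> sets borel} \<union> null_sets M"
  have "B s \<in> borel_measurable M" if "s \<ge> 0" for s using bm that by (simp add: brownian_motion_def)
  then have G: "?G \<subseteq> sets M" by (auto intro: measurable_sets)
  have sp: "space (natural_filtration M B t) = space M"
    unfolding natural_filtration_def by (rule space_measure_of_conv)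
  have "sets (natural_filtration M B t) = sigma_sets (space M) ?G"
    unfolding natural_filtration_def using G sets.sets_into_space by (intro sets_measure_of) blast
  also have "\<dots> \<subseteq> sets M" using G by (rule sets.sigma_sets_subset)
  finally have "sets (natural_filtration M B t) \<subseteq> sets M" .
  moreover have "X t \<in> borel_measurable (natural_filtration M B t)"
    using ad \<open>t \<ge> 0\<close> by (simp add: adapted_process_def)
  ultimately show ?thesis using sp by (auto simp: measurable_def)
qed

theorem theorem14:
  fixes M :: "'a measure" and B I X :: "real \<Rightarrow> 'a \<Rightarrow> real"
    and f \<sigma> :: "real \<Rightarrow> real" and \<xi> :: real
  assumes f_lipschitz: "local_lipschitz (UNIV :: real set) UNIV (\<lambda>_. f)"
    and f_mono: "mono f"
    and f_odd: "\<And>x. f (- x) = - f x"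
    and f_zero: "f 0 = 0"
    and f_sign: "\<And>x. x \<noteq> 0 \<Longrightarrow> x * f x > 0"
    and Phi: "\<exists>\<epsilon>\<^sub>0. 0 < \<epsilon>\<^sub>0 \<and> \<epsilon>\<^sub>0 < 1 \<and> (\<forall>\<epsilon>. 0 < \<epsilon> \<and> \<epsilon> < \<epsilon>\<^sub>0 \<longrightarrow> Phi_low f \<epsilon> > 0) \<and>
                (Phi_low f \<longlongrightarrow> 1) (at_right 0)"
    and f_limsup: "\<And>\<mu>. 0 < \<mu> \<Longrightarrow> \<mu> < 1 \<Longrightarrow>
                Limsup (at_right 0) (\<lambda>x. ereal (f (\<mu> * x) / f x)) < ereal \<mu>"
    and sigma_cont: "continuous_on {0..} \<sigma>"
    and brownian: "brownian_motion M B"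
    and ito: "ito_integral_process M B \<sigma> I"
    and solution: "sde_solution M B f I \<xi> X"
  shows "(set_integrable lborel {0<..} (\<lambda>s. (\<sigma> s)\<^sup>2) \<and>
            (AE \<omega> in M. ((\<lambda>t. tail_integral I t \<omega> / F_inv f t) \<longlongrightarrow> 0) at_top))
         \<longleftrightarrow>
         (\<exists>\<Lambda> \<in> borel_measurable M. (\<forall>\<omega> \<in> space M. \<Lambda> \<omega> \<in> {1, 0, - 1 :: real}) \<and>
            (AE \<omega> in M. ((\<lambda>t. X t \<omega> / F_inv f t) \<longlongrightarrow> \<Lambda> \<omega>) at_top))"
proof -
  have Phi1: "(Phi_low f \<longlongrightarrow> 1) (at_right 0)" using Phi by blast
  interpret nonlinearity f
    by unfold_locales (fact f_lipschitz f_mono f_odd f_sign Phi1 f_limsup)+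
  have X_cont: "AE \<omega> in M. continuous_on {0..} (\<lambda>t. X t \<omega>)"
    and X_eq: "AE \<omega> in M. \<forall>t\<ge>0. X t \<omega> = \<xi> - (LBINT s:{0..t}. f (X s \<omega>)) + I t \<omega>"
    and X_adapted: "adapted_process M B X"
    using solution by (auto simp: sde_solution_def)
  have [measurable]: "X (real n) \<in> borel_measurable M" for n
    by (rule adapted_measurable[OF brownian X_adapted]) simp
  show ?thesis
  proof (intro iffI)
    assume A: "set_integrable lborel {0<..} (\<lambda>s. (\<sigma> s)\<^sup>2) \<and>
      (AE \<omega> in M. ((\<lambda>t. tail_integral I t \<omega> / F_inv f t) \<longlongrightarrow> 0) at_top)"
    \<comment> \<open>A limit along the integers is measurable; where the sequence diverges,
      \<open>lim\<close> has some default value.\<close>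
    define L where "L \<omega> = lim (\<lambda>n. X (real n) \<omega> / F_inv f (real n))" for \<omega>
    \<comment> \<open>Rounding enforces the three values also on the exceptional null set and
      changes nothing elsewhere.\<close>
    define \<Lambda> where "\<Lambda> \<omega> = (if L \<omega> = 1 then 1 else if L \<omega> = - 1 then - 1 else 0 :: real)" for \<omega>
    have [measurable]: "L \<in> borel_measurable M" unfolding L_def by measurable
    have "\<Lambda> \<in> borel_measurable M" unfolding \<Lambda>_def by measurable
    moreover have "\<forall>\<omega>\<in>space M. \<Lambda> \<omega> \<in> {1, 0, - 1}" by (auto simp: \<Lambda>_def)
    moreover have "AE \<omega> in M. ((\<lambda>t. X t \<omega> / F_inv f t) \<longlongrightarrow> \<Lambda> \<omega>) at_top"
      using X_cont X_eq A[THEN conjunct2]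
    proof eventually_elim
      case (elim \<omega>)
      \<comment> \<open>The constant \<open>c\<close> is the \<open>Lim\<close> value that occurs in
        \<open>tail_integral\<close>.\<close>
      obtain l where l: "l \<in> {1, 0, -1}" "((\<lambda>t. X t \<omega> / F_inv f t) \<longlongrightarrow> l) at_top"
        using path_limit_of_tail[OF elim(1), of \<xi> "\<lambda>t. I t \<omega>" "Lim at_top (\<lambda>T. I T \<omega>)"] elim(2,3)
        unfolding tail_integral_def by blast
      have "L \<omega> = l"
        unfolding L_def using filterlim_compose[OF l(2) filterlim_real_sequentially] by (rule limI)
      then have "\<Lambda> \<omega> = l" using l(1) by (auto simp: \<Lambda>_def)
      with l(2) show ?case by simp
    qed
    ultimately show "\<exists>\<Lambda> \<in> borel_measurable M. (\<forall>\<omega> \<in> space M. \<Lambda> \<omega> \<in> {1, 0, - 1 :: real}) \<and>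
      (AE \<omega> in M. ((\<lambda>t. X t \<omega> / F_inv f t) \<longlongrightarrow> \<Lambda> \<omega>) at_top)" by blast
  next
    assume "\<exists>\<Lambda> \<in> borel_measurable M. (\<forall>\<omega> \<in> space M. \<Lambda> \<omega> \<in> {1, 0, - 1 :: real}) \<and>
      (AE \<omega> in M. ((\<lambda>t. X t \<omega> / F_inv f t) \<longlongrightarrow> \<Lambda> \<omega>) at_top)"
    then obtain \<Lambda> where val: "\<forall>\<omega> \<in> space M. \<Lambda> \<omega> \<in> {1, 0, - 1 :: real}"
      and lim: "AE \<omega> in M. ((\<lambda>t. X t \<omega> / F_inv f t) \<longlongrightarrow> \<Lambda> \<omega>) at_top" by blast
    have tail: "AE \<omega> in M. \<exists>c. ((\<lambda>t. I t \<omega>) \<longlongrightarrow> c) at_top \<and> ((\<lambda>t. (c - I t \<omega>) / F_inv f t) \<longlongrightarrow> 0) at_top"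
      using X_cont X_eq lim AE_space
    proof eventually_elim
      case (elim \<omega>)
      then show ?case
        using path_tail_of_limit[OF elim(1), of \<xi> "\<lambda>t. I t \<omega>" "\<Lambda> \<omega>"] val by blast
    qed
    \<comment> \<open>Convergent paths are bounded at integer times, the input for square
      integrability of \<open>\<sigma>\<close>.\<close>
    have "AE \<omega> in M. \<exists>C. \<forall>n. \<bar>I (real n) \<omega>\<bar> \<le> C"
      using tail
    proof eventually_elim
      case (elim \<omega>)
      then obtain c where "((\<lambda>t. I t \<omega>) \<longlongrightarrow> c) at_top" by blast
      then have "convergent (\<lambda>n. I (real n) \<omega>)"
        using filterlim_compose[OF _ filterlim_real_sequentially] unfolding convergent_def by blast
      from Bseq_eq_bounded[THEN iffD1, OF convergent_imp_Bseq[OF this]]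
      show ?case by (auto simp: bounded_iff)
    qed
    then have "set_integrable lborel {0<..} (\<lambda>s. (\<sigma> s)\<^sup>2)"
      by (rule bounded_ito_integral_imp_square_integrable[OF brownian sigma_cont ito])
    moreover have "AE \<omega> in M. ((\<lambda>t. tail_integral I t \<omega> / F_inv f t) \<longlongrightarrow> 0) at_top"
      using tail
    proof eventually_elim
      case (elim \<omega>)
      then obtain c where c: "((\<lambda>t. I t \<omega>) \<longlongrightarrow> c) at_top" "((\<lambda>t. (c - I t \<omega>) / F_inv f t) \<longlongrightarrow> 0) at_top"
        by blast
      have "Lim at_top (\<lambda>t. I t \<omega>) = c" by (rule tendsto_Lim[OF _ c(1)]) simp
      with c(2) show ?case by (simp add: tail_integral_def)
    qed
    ultimately show "set_integrable lborel {0<..} (\<lambda>s. (\<sigma> s)\<^sup>2) \<and>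
      (AE \<omega> in M. ((\<lambda>t. tail_integral I t \<omega> / F_inv f t) \<longlongrightarrow> 0) at_top)" by blast
  qed
qed

end
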